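(* Fix $\Delta\ge 3$ and $\delta \in (0,1)$. Let $(G_n)$ be any sequence of graphs, $G_n$ having $n$ vertices and maximum degree at most $\Delta$, and let $(\lambda_n)$ be any sequence of positive reals with $n \lambda_n \to \infty$ and $\lambda_n \le (1-\delta) \lambda_c(\Delta)$. Let $Y_n$ be the size of a random independent set drawn from the hard-core model on $G_n$ at fugacity $\lambda_n$, with mean $\mu_n$ and variance $\sigma_n^2$. Then $Y_n$ satisfies a local central limit theorem, i.e. \[\sup_{k \in \mathbb{Z}} \left| \mathbb{P}[Y_n=k] - \frac{1}{\sqrt{2 \pi} \sigma_n} e^{ -(k-\mu_n)^2/(2 \sigma_n^2)}\right| = o\left( \sigma_n^{-1} \right) \quad (n\to\infty).\]
   Context: The hard-core model on a graph $G$ at fugacity $\lambda>0$ is the probability distribution on the set $\mathcal{I}(G)$ of independent sets of $G$ (including the empty set) given by $\mu_{G,\lambda}(I) = \lambda^{|I|}/Z_G(\lambda)$, where $Z_G(\lambda) = \sum_{I \in \mathcal{I}(G)}\lambda^{|I|}$. For $\Delta\ge 3$, $\lambda_c(\Delta) = \frac{(\Delta-1)^{\Delta-1}}{(\Delta-2)^{\Delta}}$. *)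

theory Defs
  imports
    "HOL-Probability.Probability"
    "HOL-Library.Landau_Symbols"
    "Graph_Theory.Pair_Digraph"
begin

text \<open>
  Finite simple graphs are rendered by the locale \<open>pair_graph\<close>: finitely many vertices and a symmetric,
  irreflexive set of arcs. An edge \<open>uv\<close> is the pair of arcs \<open>(u,v)\<close>, \<open>(v,u)\<close>, so the
  degree of a vertex is its out-degree.
\<close>

definition max_degree :: "'a pair_pre_digraph \<Rightarrow> nat" where
  "max_degree G = Max (out_degree (with_proj G) ` pverts G)"

definition independent_sets :: "'a pair_pre_digraph \<Rightarrow> 'a set set" where
  "independent_sets G = {I. I \<subseteq> pverts G \<and> (\<forall>u\<in>I. \<forall>v\<in>I. (u, v) \<notin> parcs G)}"

definition partition_function :: "'a pair_pre_digraph \<Rightarrow> real \<Rightarrow> real" where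
  "partition_function G l = (\<Sum>I\<in>independent_sets G. l ^ card I)"

definition hard_core :: "'a pair_pre_digraph \<Rightarrow> real \<Rightarrow> 'a set pmf" where
  "hard_core G l =
     embed_pmf (\<lambda>I. if I \<in> independent_sets G then l ^ card I / partition_function G l else 0)"

definition hard_core_mean :: "'a pair_pre_digraph \<Rightarrow> real \<Rightarrow> real" where
  "hard_core_mean G l = measure_pmf.expectation (hard_core G l) (\<lambda>I. real (card I))"

definition hard_core_sd :: "'a pair_pre_digraph \<Rightarrow> real \<Rightarrow> real" where
  "hard_core_sd G l = sqrt (measure_pmf.variance (hard_core G l) (\<lambda>I. real (card I)))"

definition critical_fugacity :: "nat \<Rightarrow> real" where
  "critical_fugacity D = (real D - 1) ^ (D - 1) / (real D - 2) ^ D"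

lemma finite_independent_sets: "pair_graph G \<Longrightarrow> finite (independent_sets G)"
  unfolding independent_sets_def
  by (rule finite_subset[of _ "Pow (pverts G)"])
     (auto simp: pair_graph_def pair_digraph_def pair_fin_digraph_def pair_fin_digraph_axioms_def)

lemma partition_function_pos:
  assumes "pair_graph G" "l > 0"
  shows "partition_function G l > 0"
proof -
  have "{} \<in> independent_sets G"
    by (auto simp: independent_sets_def)
  then show ?thesis
    unfolding partition_function_def using assms finite_independent_sets[OF assms(1)]
    by (intro sum_pos) auto
qed

lemma pmf_hard_core:
  assumes "pair_graph G" "l > 0"
  shows "pmf (hard_core G l) I =
    (if I \<in> independent_sets G then l ^ card I / partition_function G l else 0)"
proof -
  let ?A = "independent_sets G" and ?Z = "partition_function G l"
  let ?f = "\<lambda>I. if I \<in> ?A then l ^ card I / ?Z else 0"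
  have fin: "finite ?A" and Z: "?Z > 0"
    using assms finite_independent_sets partition_function_pos by auto
  have nn: "?f I \<ge> 0" for I
    using Z assms(2) by simp
  have "(\<integral>\<^sup>+I. ennreal (?f I) \<partial>count_space UNIV) = (\<Sum>I\<in>?A. ennreal (?f I))"
    by (rule nn_integral_count_space'[OF fin]) auto
  also have "\<dots> = ennreal (\<Sum>I\<in>?A. ?f I)"
    by (rule sum_ennreal) (rule nn)
  also have "(\<Sum>I\<in>?A. ?f I) = ?Z / ?Z"
    by (simp add: partition_function_def flip: sum_divide_distrib)
  also have "\<dots> = 1"
    using Z by simp
  finally show ?thesis
    unfolding hard_core_def by (subst pmf_embed_pmf[OF nn]) simp_all
qed

end

theory Submission
  imports Defs "HOL-Computational_Algebra.Fundamental_Theorem_Algebra"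
begin

text \<open>
  Let \<open>Z\<close> be the independence polynomial of a graph with \<open>n\<close> vertices and \<open>\<phi> t = Z (l * exp (\<i> t)) / Z l\<close> the
  characteristic function of the size of the random independent set. Two facts about \<open>\<phi>\<close> suffice.

  Near \<open>0\<close>: \<open>Z\<close> has no zeros in a complex neighbourhood of \<open>[0, (1 - \<delta>) * \<lambda>\<^sub>c]\<close> that depends only on
  \<open>\<Delta>\<close> and \<open>\<delta>\<close> (a theorem of Peters and Regts). In the coordinate \<open>u = ln (Z A / Z (A - v))\<close> the vertex recursion
  reads \<open>u = ln (1 + z * exp (- (u\<^sub>1 + \<dots> + u\<^sub>k)))\<close>, and a convex region that contains \<open>0\<close> and is invariant under
  \<open>u \<mapsto> ln (1 + z * exp (- d * u))\<close>, \<open>d = \<Delta> - 1\<close>, is mapped into itself by it for all \<open>k \<le> d\<close>. Factoring \<open>Z\<close> over its zeros,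
  \<open>\<phi> t\<close> is a product of at most \<open>n\<close> factors \<open>1 + a * (exp (\<i> t) - 1)\<close> with \<open>a = O(l)\<close>, whence
  \<open>\<phi> t = exp (\<i> \<mu> t - \<sigma>\<^sup>2 t\<^sup>2 / 2 + O(n l t\<^sup>3))\<close> and \<open>\<sigma>\<^sup>2 = O(n l)\<close>.

  Everywhere: \<open>norm (\<phi> t) \<le> exp (- c n l t\<^sup>2)\<close> for \<open>\<bar>t\<bar> \<le> \<pi>\<close>, by conditioning outside the
  closed neighbourhoods of linearly many vertices that are far apart. Together with the expansion this also
  yields \<open>\<sigma>\<^sup>2 \<ge> 2 c n l\<close>.

  After the substitution \<open>t = s / \<sigma>\<close>, Fourier inversion bounds the error, uniformly in \<open>k\<close>, by an \<open>L\<^sup>1\<close>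
  distance that tends to \<open>0\<close> by dominated convergence.
\<close>

section \<open>Independence polynomials\<close>

definition stable_sets :: "'a rel \<Rightarrow> 'a set \<Rightarrow> 'a set set" where
  "stable_sets E A = {I. I \<subseteq> A \<and> (\<forall>u\<in>I. \<forall>v\<in>I. (u, v) \<notin> E)}"

text \<open>The edge relation stays fixed and only the vertex set shrinks under deletions. The value
  type is generic so that one sum serves real fugacities and complex arguments.\<close>

definition indep_poly :: "'a rel \<Rightarrow> 'a set \<Rightarrow> 'b::comm_semiring_1 \<Rightarrow> 'b" where
  "indep_poly E A z = (\<Sum>I\<in>stable_sets E A. z ^ card I)"

lemma finite_stable_sets: "finite A \<Longrightarrow> finite (stable_sets E A)"
  by (rule finite_subset[of _ "Pow A"]) (auto simp: stable_sets_def)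

lemma finite_stable_set: "finite A \<Longrightarrow> I \<in> stable_sets E A \<Longrightarrow> finite I"
  by (auto simp: stable_sets_def intro: finite_subset)

lemma empty_in_stable_sets: "{} \<in> stable_sets E A"
  by (simp add: stable_sets_def)

lemma indep_poly_empty [simp]: "indep_poly E {} z = 1"
proof -
  have "stable_sets E {} = {{}}" by (auto simp: stable_sets_def)
  then show ?thesis by (simp add: indep_poly_def)
qed

text \<open>Stable sets either avoid \<open>v\<close> or arise by inserting \<open>v\<close> into a
  stable set that misses its closed neighbourhood.\<close>

lemma indep_poly_rec:
  assumes "finite A" "v \<in> A" "sym E" "(v, v) \<notin> E"
  shows "indep_poly E A z = indep_poly E (A - {v}) z + z * indep_poly E (A - insert v (E `` {v})) z"
proof -
  let ?P = "stable_sets E (A - {v})" and ?Q = "stable_sets E (A - insert v (E `` {v}))"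
  have vI: "v \<notin> I" if "I \<in> ?P \<union> ?Q" for I using that by (auto simp: stable_sets_def)
  have "stable_sets E A = ?P \<union> insert v ` ?Q"
  proof (intro equalityI subsetI)
    fix I assume I: "I \<in> stable_sets E A"
    show "I \<in> ?P \<union> insert v ` ?Q"
    proof (cases "v \<in> I")
      case True
      then have "I - {v} \<in> ?Q" using I by (auto simp: stable_sets_def)
      moreover have "I = insert v (I - {v})" using True by auto
      ultimately show ?thesis by blast
    next
      case False
      then show ?thesis using I by (auto simp: stable_sets_def)
    qed
  next
    fix I assume "I \<in> ?P \<union> insert v ` ?Q"
    then show "I \<in> stable_sets E A"
      using assms by (auto simp: stable_sets_def dest: symD)
  qed
  moreover have "?P \<inter> insert v ` ?Q = {}" using vI by blast
  moreover have "finite ?P" "finite ?Q" using assms by (auto intro: finite_stable_sets)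
  moreover have "inj_on (insert v) ?Q"
    using vI by (intro inj_onI) (metis UnI2 insert_ident)
  ultimately have "indep_poly E A z = indep_poly E (A - {v}) z + (\<Sum>I\<in>?Q. z ^ card (insert v I))"
    by (simp add: indep_poly_def sum.union_disjoint sum.reindex)
  also have "(\<Sum>I\<in>?Q. z ^ card (insert v I)) = (\<Sum>I\<in>?Q. z * z ^ card I)"
  proof (rule sum.cong[OF refl])
    fix I assume I: "I \<in> ?Q"
    have "finite I" by (rule finite_stable_set[OF _ I]) (simp add: assms(1))
    moreover have "v \<notin> I" using I by (auto simp: stable_sets_def)
    ultimately show "z ^ card (insert v I) = z * z ^ card I" by simp
  qed
  finally show ?thesis by (simp add: indep_poly_def sum_distrib_left)
qed

text \<open>Sort the stable sets by their trace \<open>J\<close> on \<open>A\<close>; the rest is a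
  stable subset of \<open>B\<close> that misses the neighbours of \<open>J\<close>.\<close>

lemma indep_poly_condition:
  assumes "finite A" "finite B" "A \<inter> B = {}" "sym E"
  shows "indep_poly E (A \<union> B) z = (\<Sum>J\<in>stable_sets E A. z ^ card J * indep_poly E (B - E `` J) z)"
proof -
  have "(\<Sum>J\<in>stable_sets E A. z ^ card J * indep_poly E (B - E `` J) z)
      = (\<Sum>J\<in>stable_sets E A. \<Sum>K\<in>stable_sets E (B - E `` J). z ^ card J * z ^ card K)"
    by (simp add: indep_poly_def sum_distrib_left)
  also have "\<dots> = (\<Sum>(J, K)\<in>(SIGMA J:stable_sets E A. stable_sets E (B - E `` J)). z ^ card J * z ^ card K)"
    using assms by (intro sum.Sigma) (auto intro: finite_stable_sets)
  also have "\<dots> = (\<Sum>I\<in>stable_sets E (A \<union> B). z ^ card I)"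
  proof (rule sum.reindex_bij_witness[where j = "\<lambda>(J, K). J \<union> K" and i = "\<lambda>I. (I \<inter> A, I \<inter> B)"])
    fix a assume a: "a \<in> (SIGMA J:stable_sets E A. stable_sets E (B - E `` J))"
    then obtain J K where JK: "a = (J, K)" "J \<in> stable_sets E A" "K \<in> stable_sets E (B - E `` J)" by auto
    then have sub: "J \<subseteq> A" "K \<subseteq> B" by (auto simp: stable_sets_def)
    then show "(\<lambda>I. (I \<inter> A, I \<inter> B)) ((\<lambda>(J, K). J \<union> K) a) = a"
      using assms(3) JK by auto
    show "(\<lambda>(J, K). J \<union> K) a \<in> stable_sets E (A \<union> B)"
    proof -
      have "(u, v) \<notin> E" if "u \<in> J \<union> K" "v \<in> J \<union> K" for u v
        using JK(2,3) that assms(4) unfolding stable_sets_def sym_def by blast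
      then show ?thesis using JK(1) sub by (auto simp: stable_sets_def)
    qed
    have "finite J" "finite K" "J \<inter> K = {}"
      using sub assms finite_subset by blast+
    then show "z ^ card ((\<lambda>(J, K). J \<union> K) a) = (case a of (J, K) \<Rightarrow> z ^ card J * z ^ card K)"
      using JK by (simp add: card_Un_disjoint power_add)
  qed (use assms(3) in \<open>auto simp: stable_sets_def\<close>)
  finally show ?thesis by (simp add: indep_poly_def)
qed

text \<open>No edge joins two blocks, so conditioning on one block removes no vertex from the others
  and induction splits off one factor at a time.\<close>

lemma indep_poly_UN_prod:
  assumes "finite S" "sym E" "\<And>s. s \<in> S \<Longrightarrow> finite (B s)"
    and "\<And>s t. s \<in> S \<Longrightarrow> t \<in> S \<Longrightarrow> s \<noteq> t \<Longrightarrow> B s \<inter> B t = {} \<and> E `` B s \<inter> B t = {}"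
  shows "indep_poly E (\<Union>s\<in>S. B s) z = (\<Prod>s\<in>S. indep_poly E (B s) z)"
  using assms(1,3,4)
proof (induction S rule: finite_induct)
  case (insert s S)
  let ?R = "\<Union>s\<in>S. B s"
  have "indep_poly E (B s \<union> ?R) z = (\<Sum>J\<in>stable_sets E (B s). z ^ card J * indep_poly E (?R - E `` J) z)"
  proof (rule indep_poly_condition)
    show "finite (B s)" "finite ?R" using insert.prems insert.hyps by auto
    show "B s \<inter> ?R = {}" using insert.prems(2)[of s] insert.hyps by blast
  qed fact
  also have "\<dots> = (\<Sum>J\<in>stable_sets E (B s). z ^ card J * indep_poly E ?R z)"
  proof (rule sum.cong[OF refl])
    fix J assume "J \<in> stable_sets E (B s)"
    then have "E `` J \<subseteq> E `` B s" by (auto simp: stable_sets_def)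
    moreover have "E `` B s \<inter> ?R = {}" using insert.prems(2)[of s] insert.hyps by blast
    ultimately have "?R - E `` J = ?R" by blast
    then show "z ^ card J * indep_poly E (?R - E `` J) z = z ^ card J * indep_poly E ?R z" by simp
  qed
  also have "\<dots> = indep_poly E (B s) z * indep_poly E ?R z"
    by (simp add: sum_distrib_right indep_poly_def[of E "B s"])
  finally show ?case using insert by simp
qed simp

lemma indep_poly_ge_1:
  fixes A :: "'a set"
  assumes "finite A" "(x::real) \<ge> 0"
  shows "indep_poly E A x \<ge> 1"
proof -
  have "(\<Sum>I\<in>{{} :: 'a set}. x ^ card I) \<le> indep_poly E A x"
    unfolding indep_poly_def using assms
    by (intro sum_mono2) (auto intro: finite_stable_sets empty_in_stable_sets)
  then show ?thesis by simp
qed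

lemma indep_poly_mono:
  assumes "finite A" "(x::real) \<ge> 0" "B \<subseteq> A"
  shows "indep_poly E B x \<le> indep_poly E A x"
  unfolding indep_poly_def using assms
  by (intro sum_mono2) (auto intro: finite_stable_sets simp: stable_sets_def)

lemma indep_poly_le_power:
  assumes "finite A" "(x::real) \<ge> 0" "sym E" "irrefl E"
  shows "indep_poly E A x \<le> (1 + x) ^ card A"
  using assms(1)
proof (induction A rule: finite_induct)
  case (insert v A)
  have "indep_poly E (insert v A) x
      = indep_poly E (insert v A - {v}) x + x * indep_poly E (insert v A - insert v (E `` {v})) x"
    using insert assms by (intro indep_poly_rec) (auto simp: irrefl_def)
  also have "\<dots> \<le> indep_poly E A x + x * indep_poly E A x"
    using insert assms by (intro add_mono mult_left_mono indep_poly_mono) auto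
  also have "\<dots> = (1 + x) * indep_poly E A x" by (simp add: algebra_simps)
  also have "\<dots> \<le> (1 + x) * (1 + x) ^ card A"
    using insert assms by (intro mult_left_mono) auto
  finally show ?case using insert by simp
qed simp

section \<open>Conditioning outside separated blocks\<close>

text \<open>Given the trace \<open>J\<close> outside the blocks, the remaining polynomial factors
  over the blocks and each block gains a factor \<open>q\<close>. The triangle inequality over
  \<open>J\<close> is harmless because the weights \<open>norm z ^ card J\<close> recombine to the
  polynomial at \<open>norm z\<close>.\<close>

lemma norm_indep_poly_le_prod:
  fixes z :: complex
  assumes "finite V" "sym E" "finite S" "\<And>s. s \<in> S \<Longrightarrow> B s \<subseteq> V"
    and sep: "\<And>s t. s \<in> S \<Longrightarrow> t \<in> S \<Longrightarrow> s \<noteq> t \<Longrightarrow> B s \<inter> B t = {} \<and> E `` B s \<inter> B t = {}"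
    and bound: "\<And>s J. s \<in> S \<Longrightarrow> J \<inter> B s = {} \<Longrightarrow>
      norm (indep_poly E (B s - E `` J) z) \<le> q * indep_poly E (B s - E `` J) (norm z)"
  shows "norm (indep_poly E V z) \<le> q ^ card S * indep_poly E V (norm z)"
proof -
  let ?U = "\<Union>s\<in>S. B s" and ?A = "V - (\<Union>s\<in>S. B s)"
  have V: "?A \<union> ?U = V" using assms(4) by auto
  have fin: "finite ?A" "finite ?U" "\<And>s. s \<in> S \<Longrightarrow> finite (B s)"
    using assms(1,3,4) by (auto intro: finite_subset)
  have split: "indep_poly E V x = (\<Sum>J\<in>stable_sets E ?A. x ^ card J * indep_poly E (?U - E `` J) x)"
    for x :: "'c::comm_semiring_1"
    using indep_poly_condition[OF fin(1,2) _ assms(2), of x] V by auto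
  have fac: "indep_poly E (?U - E `` J) x = (\<Prod>s\<in>S. indep_poly E (B s - E `` J) x)"
    for J and x :: "'c::comm_semiring_1"
  proof -
    have "indep_poly E (\<Union>s\<in>S. B s - E `` J) x = (\<Prod>s\<in>S. indep_poly E (B s - E `` J) x)"
    proof (rule indep_poly_UN_prod[OF assms(3,2)])
      fix s t assume "s \<in> S" "t \<in> S" "s \<noteq> t"
      from sep[OF this] show "(B s - E `` J) \<inter> (B t - E `` J) = {} \<and> E `` (B s - E `` J) \<inter> (B t - E `` J) = {}"
        by blast
    qed (simp add: fin(3))
    moreover have "(\<Union>s\<in>S. B s - E `` J) = ?U - E `` J" by auto
    ultimately show ?thesis by simp
  qed
  have "norm (indep_poly E (?U - E `` J) z) \<le> q ^ card S * indep_poly E (?U - E `` J) (norm z)"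
    if J: "J \<in> stable_sets E ?A" for J
  proof -
    have "norm (indep_poly E (?U - E `` J) z) = (\<Prod>s\<in>S. norm (indep_poly E (B s - E `` J) z))"
      by (simp add: fac prod_norm)
    also have "\<dots> \<le> (\<Prod>s\<in>S. q * indep_poly E (B s - E `` J) (norm z))"
    proof (rule prod_mono, safe)
      fix s assume s: "s \<in> S"
      have "J \<inter> B s = {}" using J s by (auto simp: stable_sets_def)
      then show "norm (indep_poly E (B s - E `` J) z) \<le> q * indep_poly E (B s - E `` J) (norm z)"
        using bound[OF s] by blast
    qed simp
    also have "\<dots> = q ^ card S * indep_poly E (?U - E `` J) (norm z)"
      by (simp add: fac prod.distrib)
    finally show ?thesis .
  qed
  then have "norm (indep_poly E V z)
      \<le> (\<Sum>J\<in>stable_sets E ?A. norm z ^ card J * (q ^ card S * indep_poly E (?U - E `` J) (norm z)))"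
    unfolding split by (intro sum_norm_le) (simp add: norm_mult norm_power mult_left_mono)
  also have "\<dots> = q ^ card S * indep_poly E V (norm z)"
    unfolding split by (simp add: sum_distrib_left mult_ac)
  finally show ?thesis .
qed

text \<open>Take a maximal set with the separation property. By maximality every vertex lies within
  distance three of it, and a ball of radius three has at most \<open>(D + 1) ^ 3\<close>
  vertices.\<close>

lemma separated_set_exists:
  assumes "finite V" "E \<subseteq> V \<times> V" "sym E" and deg: "\<And>v. card (E `` {v}) \<le> D"
  obtains S where "S \<subseteq> V" "card V \<le> card S * (D + 1) ^ 3"
    "\<And>s t. s \<in> S \<Longrightarrow> t \<in> S \<Longrightarrow> s \<noteq> t \<Longrightarrow>
       insert s (E `` {s}) \<inter> insert t (E `` {t}) = {} \<and> E `` insert s (E `` {s}) \<inter> insert t (E `` {t}) = {}"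
proof -
  define N where "N X = X \<union> E `` X" for X
  have cardN: "finite (N X) \<and> card (N X) \<le> card X * (D + 1)" if "finite X" for X
  proof
    have finE: "finite (E `` Y)" for Y
      by (rule finite_subset[OF _ assms(1)]) (use assms(2) in auto)
    then show "finite (N X)" using that by (auto simp: N_def)
    have "card (E `` X) = card (\<Union>x\<in>X. E `` {x})" by (metis Image_eq_UN)
    also have "\<dots> \<le> (\<Sum>x\<in>X. card (E `` {x}))" using that by (rule card_UN_le)
    also have "\<dots> \<le> (\<Sum>x\<in>X. D)" using deg by (rule sum_mono)
    finally show "card (N X) \<le> card X * (D + 1)"
      unfolding N_def using card_Un_le[of X "E `` X"] by (simp add: algebra_simps)
  qed
  define P where "P S \<longleftrightarrow> S \<subseteq> V \<and> (\<forall>s\<in>S. \<forall>t\<in>S. s \<noteq> t \<longrightarrow> N (N {s}) \<inter> N {t} = {})" for S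
  have PV: "S \<subseteq> V" if "P S" for S
    using that unfolding P_def by (rule conjunct1)
  have PN: "N (N {s}) \<inter> N {t} = {}" if "P S" "s \<in> S" "t \<in> S" "s \<noteq> t" for S s t
    using that unfolding P_def by blast
  have "finite (Collect P)"
    by (rule finite_subset[of _ "Pow V"]) (use assms(1) PV in auto)
  moreover have "P {}" by (simp add: P_def)
  ultimately obtain S where S: "P S" and max: "\<And>T. P T \<Longrightarrow> S \<subseteq> T \<Longrightarrow> S = T"
    using finite_has_maximal[of "Collect P"] by blast
  have finS: "finite S" using PV[OF S] assms(1) by (rule finite_subset)
  have sym': "N (N {s}) \<inter> N {t} = {} \<Longrightarrow> N (N {t}) \<inter> N {s} = {}" for s t
    using assms(3) unfolding N_def sym_def by blast
  have self: "x \<in> N (N (N {x}))" for x by (simp add: N_def)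
  have "V \<subseteq> (\<Union>s\<in>S. N (N (N {s})))"
  proof
    fix v assume v: "v \<in> V"
    show "v \<in> (\<Union>s\<in>S. N (N (N {s})))"
    proof (rule ccontr)
      assume neg: "\<not> ?thesis"
      have sep: "N (N {s}) \<inter> N {v} = {}" if "s \<in> S" for s
      proof (rule ccontr)
        assume "N (N {s}) \<inter> N {v} \<noteq> {}"
        then have "v \<in> N (N (N {s}))" using assms(3) unfolding N_def[of "N (N {s})"] N_def[of "{v}"] sym_def
          by blast
        then show False using neg that by blast
      qed
      have "P (insert v S)"
        unfolding P_def
      proof (intro conjI ballI impI)
        show "insert v S \<subseteq> V" using PV[OF S] v by blast
        fix s t assume st: "s \<in> insert v S" "t \<in> insert v S" "s \<noteq> t"
        then consider "s \<in> S" "t \<in> S" | "s = v" "t \<in> S" | "s \<in> S" "t = v" by auto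
        then show "N (N {s}) \<inter> N {t} = {}"
        proof cases
          case 1
          then show ?thesis using PN[OF S] st(3) by blast
        next
          case 2
          then show ?thesis using sep sym' by blast
        next
          case 3
          then show ?thesis using sep by blast
        qed
      qed
      then have "v \<in> S" using max by blast
      then show False using neg self by blast
    qed
  qed
  then have "card V \<le> card (\<Union>s\<in>S. N (N (N {s})))"
    using finS cardN by (intro card_mono) auto
  also have "\<dots> \<le> (\<Sum>s\<in>S. card (N (N (N {s}))))" using finS by (rule card_UN_le)
  also have "\<dots> \<le> (\<Sum>s\<in>S. (D + 1) ^ 3)"
  proof (rule sum_mono)
    fix s
    have 1: "finite (N {s})" "card (N {s}) \<le> D + 1" using cardN[of "{s}"] by auto
    have 2: "finite (N (N {s}))" "card (N (N {s})) \<le> card (N {s}) * (D + 1)" using cardN[OF 1(1)] by auto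
    have 3: "card (N (N (N {s}))) \<le> card (N (N {s})) * (D + 1)" using cardN[OF 2(1)] by auto
    note 3
    also have "card (N (N {s})) * (D + 1) \<le> ((D + 1) * (D + 1)) * (D + 1)"
      using 2(2) 1(2) by (meson le_trans mult_le_mono1)
    finally show "card (N (N (N {s}))) \<le> (D + 1) ^ 3" by (simp add: power3_eq_cube)
  qed
  finally have "card V \<le> card S * (D + 1) ^ 3" by simp
  moreover have "insert s (E `` {s}) \<inter> insert t (E `` {t}) = {} \<and> E `` insert s (E `` {s}) \<inter> insert t (E `` {t}) = {}"
    if "s \<in> S" "t \<in> S" "s \<noteq> t" for s t
  proof -
    have "N (N {s}) \<inter> N {t} = {}" using PN[OF S] that by blast
    then show ?thesis unfolding N_def by blast
  qed
  ultimately show ?thesis using that PV[OF S] by blast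
qed

section \<open>An invariant region for the tree recursion\<close>

lemma cos_ge_quadratic: "1 - x\<^sup>2 / 2 \<le> cos (x::real)"
proof -
  have "cos x = 1 - 2 * (sin (x / 2))\<^sup>2" using cos_double_sin[of "x / 2"] by simp
  moreover have "(sin (x / 2))\<^sup>2 \<le> (x / 2)\<^sup>2" using abs_sin_x_le_abs_x[of "x / 2"] abs_le_square_iff by blast
  ultimately show ?thesis by (simp add: power2_eq_square)
qed

text \<open>
  With \<open>g u = ln (1 + l * exp (- d * u))\<close> and \<open>h x = x + region_shift d\<close>, one has \<open>\<bar>g' u\<bar> * h u \<le> h (g u)\<close>
  up to the critical fugacity, so \<open>h\<close> is a profile of widths that the recursion respects. The constant is
  forced by the fixed point \<open>u = ln (1 + 1 / (d - 1))\<close> of the critical recursion, where \<open>g' u = -1\<close>.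
\<close>

definition region_shift :: "real \<Rightarrow> real" where
  "region_shift d = 2 / (d - 1) - ln (1 + 1 / (d - 1))"

lemma region_shift_pos: "d > 1 \<Longrightarrow> region_shift d > 0"
proof -
  assume d: "d > 1"
  have "ln (1 + 1 / (d - 1)) \<le> 1 / (d - 1)" using d by (intro ln_add_one_self_le_self) auto
  moreover have "2 / (d - 1) = 1 / (d - 1) + 1 / (d - 1)" by simp
  ultimately show ?thesis unfolding region_shift_def using d by (smt (verit) divide_pos_pos)
qed

text \<open>
  The assumption on \<open>u\<close> says that \<open>s = exp (- d * u) * d powr d / (d - 1) powr (d + 1)\<close>, that is, \<open>ln (1 + s)\<close>
  is the image of \<open>u\<close> at the critical fugacity; \<open>G\<close> below is the slack of the inequality times \<open>1 + 1 / s\<close>, and it is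
  minimal, with value \<open>0\<close>, at the fixed point \<open>s0\<close>.
\<close>

lemma critical_contraction:
  fixes d s u :: real
  assumes d: "d > 1" and s: "s > 0"
    and u: "d * u = d * ln d - (d + 1) * ln (d - 1) - ln s"
  shows "s / (1 + s) * (d * (u + region_shift d)) \<le> ln (1 + s) + region_shift d"
proof -
  let ?c = "region_shift d"
  define s0 where "s0 = 1 / (d - 1)"
  have s0: "s0 > 0" using d by (simp add: s0_def)
  define G where "G x = (ln (1 + x) + ?c) * (1 + 1 / x) - d * ?c - (d * ln d - (d + 1) * ln (d - 1)) + ln x" for x
  have c: "?c = 2 * s0 - ln (1 + s0)" by (simp add: region_shift_def s0_def)
  \<comment> \<open>The numerator vanishes at \<open>s0\<close> because
    \<open>?c = 2 * s0 - ln (1 + s0)\<close>. Since \<open>log_lip\<close> makes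
    \<open>2 * x - ln (1 + x)\<close> increasing, this fixes the sign of the derivative on both
    sides of \<open>s0\<close>.\<close>
  have deriv: "(G has_real_derivative (2 * x - ln (1 + x) - ?c) / x\<^sup>2) (at x)" if "x > 0" for x
  proof -
    have "(G has_real_derivative
        (1 / (1 + x)) * (1 + 1 / x) + (ln (1 + x) + ?c) * (- 1 / x\<^sup>2) + 1 / x) (at x)"
    proof -
      have h1: "((\<lambda>x. 1 + 1 / x) has_real_derivative (- 1 / x\<^sup>2)) (at x)"
        using that by (auto intro!: derivative_eq_intros simp: power2_eq_square)
      have h2: "((\<lambda>x. ln (1 + x) + ?c) has_real_derivative 1 / (1 + x)) (at x)"
        using that by (auto intro!: derivative_eq_intros)
      have h3: "(ln has_real_derivative 1 / x) (at x)"
        using that by (rule DERIV_ln_divide)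
      show ?thesis
        unfolding G_def
        by (rule DERIV_cong, rule DERIV_add[OF DERIV_diff[OF DERIV_diff[OF DERIV_mult[OF h2 h1] DERIV_const] DERIV_const] h3])
          (simp add: algebra_simps)
    qed
    moreover have "(1 / (1 + x)) * (1 + 1 / x) + (ln (1 + x) + ?c) * (- 1 / x\<^sup>2) + 1 / x
        = (2 * x - ln (1 + x) - ?c) / x\<^sup>2"
    proof -
      have "(1 / (1 + x)) * (1 + 1 / x) = 1 / x" using that by (simp add: field_simps)
      then show ?thesis using that by (simp add: field_simps power2_eq_square)
    qed
    ultimately show ?thesis by simp
  qed
  have log_lip: "ln (1 + y) - ln (1 + x) \<le> y - x" if "0 < x" "x \<le> y" for x y :: real
  proof -
    have "ln (1 + y) - ln (1 + x) \<le> ((1 + y) - (1 + x)) / (1 + x)" using that by (intro ln_diff_le) auto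
    also have "\<dots> \<le> (y - x) / 1" using that by (intro frac_le) auto
    finally show ?thesis by simp
  qed
  have "G s0 = 0"
  proof -
    have "1 + 1 / s0 = d" "1 + s0 = d / (d - 1)" using d by (auto simp: s0_def field_simps)
    then show ?thesis using d by (simp add: G_def ln_div s0_def algebra_simps)
  qed
  moreover have "G s0 \<le> G s"
  proof (cases "s0 \<le> s")
    case True
    show ?thesis
    proof (rule DERIV_nonneg_imp_nondecreasing[OF True])
      fix x assume "s0 \<le> x" "x \<le> s"
      then show "\<exists>y. (G has_real_derivative y) (at x) \<and> 0 \<le> y"
        using deriv[of x] log_lip[of s0 x] s0 c by (intro exI conjI) (auto intro!: divide_nonneg_nonneg)
    qed
  next
    case False
    then have "s \<le> s0" by simp
    then show ?thesis
    proof (rule DERIV_nonpos_imp_nonincreasing)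
      fix x assume "s \<le> x" "x \<le> s0"
      then show "\<exists>y. (G has_real_derivative y) (at x) \<and> y \<le> 0"
        using deriv[of x] log_lip[of x s0] s c by (intro exI conjI) (auto intro!: divide_nonpos_nonneg)
    qed
  qed
  ultimately have "G s \<ge> 0" by simp
  moreover have "d * (u + ?c) = (ln (1 + s) + ?c) * (1 + 1 / s) - G s"
    using u by (simp add: G_def algebra_simps)
  ultimately have "d * (u + ?c) \<le> (ln (1 + s) + ?c) * (1 + 1 / s)" by simp
  then have "s / (1 + s) * (d * (u + ?c)) \<le> s / (1 + s) * ((ln (1 + s) + ?c) * (1 + 1 / s))"
    using s by (intro mult_left_mono) auto
  also have "\<dots> = (ln (1 + s) + ?c) * (s / (1 + s) * (1 + 1 / s))" by (simp only: mult_ac)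
  also have "s / (1 + s) * (1 + 1 / s) = 1"
  proof -
    have "1 + 1 / s = (1 + s) / s" "1 + s \<noteq> 0" using s by (auto simp: field_simps)
    then show ?thesis using s by simp
  qed
  finally show ?thesis by simp
qed

text \<open>Being below criticality by a factor \<open>exp (- L)\<close> puts \<open>x\<close> at
  least \<open>L / d\<close> to the left of the critical preimage of \<open>s\<close>, which gains
  \<open>s / (1 + s) * L\<close>. For small \<open>s\<close> this gain degenerates, but then the
  left-hand side is at most half of \<open>region_shift d\<close>.\<close>

lemma subcritical_contraction_gap:
  fixes d L X :: real
  assumes d: "d > 1" and L: "L > 0" and X: "X > 0"
  obtains \<kappa> where "\<kappa> > 0"
    "\<And>l x. 0 \<le> l \<Longrightarrow> (l > 0 \<Longrightarrow> ln l + L \<le> d * ln d - (d + 1) * ln (d - 1)) \<Longrightarrow> x \<le> X \<Longrightarrow>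
      l * exp (- d * x) / (1 + l * exp (- d * x)) * (d * (x + region_shift d))
        \<le> ln (1 + l * exp (- d * x)) + region_shift d - \<kappa>"
proof -
  let ?c = "region_shift d"
  have c: "?c > 0" using region_shift_pos[OF d] .
  \<comment> \<open>Chosen so that \<open>s0 * (d * (X + ?c)) = ?c / 2\<close>.\<close>
  define s0 where "s0 = ?c / (2 * d * (X + ?c))"
  have s0: "s0 > 0" using c d X by (simp add: s0_def)
  define \<kappa> where "\<kappa> = min (?c / 2) (s0 / (1 + s0) * L)"
  have "\<kappa> > 0" using c s0 L by (simp add: \<kappa>_def)
  moreover have "l * exp (- d * x) / (1 + l * exp (- d * x)) * (d * (x + ?c))
        \<le> ln (1 + l * exp (- d * x)) + ?c - \<kappa>"
    if l: "0 \<le> l" "l > 0 \<Longrightarrow> ln l + L \<le> d * ln d - (d + 1) * ln (d - 1)" and x: "x \<le> X" for l x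
  proof -
    define s where "s = l * exp (- d * x)"
    have s: "s \<ge> 0" using l by (simp add: s_def)
    have "s / (1 + s) * (d * (x + ?c)) \<le> ln (1 + s) + ?c - \<kappa>"
    proof (cases "s < s0")
      case True
      have "s / (1 + s) * (d * (x + ?c)) \<le> s / (1 + s) * (d * (X + ?c))"
        using s d x by (intro mult_left_mono) auto
      also have "\<dots> \<le> s0 * (d * (X + ?c))"
      proof (rule mult_right_mono)
        have "s / (1 + s) \<le> s / 1" using s by (intro divide_left_mono) auto
        then show "s / (1 + s) \<le> s0" using True by simp
      qed (use d X c in auto)
      also have "\<dots> = ?c / 2"
      proof -
        have "d * (X + ?c) \<noteq> 0" using d X c by simp
        then show ?thesis unfolding s0_def mult.assoc[of 2 d] by (simp only: times_divide_eq_left) simp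
      qed
      also have "\<dots> \<le> ln (1 + s) + ?c - \<kappa>"
      proof -
        have "ln (1 + s) \<ge> 0" using s by simp
        moreover have "\<kappa> \<le> ?c / 2" unfolding \<kappa>_def by (rule min.cobounded1)
        ultimately show ?thesis by linarith
      qed
      finally show ?thesis .
    next
      case False
      then have sp: "s > 0" using s0 by simp
      then have lp: "l > 0" using l(1) by (auto simp: s_def zero_less_mult_iff)
      define u where "u = (d * ln d - (d + 1) * ln (d - 1) - ln s) / d"
      have "ln s = ln l - d * x" using lp by (simp add: s_def ln_mult)
      then have "d * x + L \<le> d * u" using l(2)[OF lp] d by (simp add: u_def)
      then have "s / (1 + s) * (d * (x + ?c)) \<le> s / (1 + s) * (d * (u + ?c) - L)"
        using sp by (intro mult_left_mono) (auto simp: algebra_simps)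
      also have "\<dots> = s / (1 + s) * (d * (u + ?c)) - s / (1 + s) * L" by (simp add: algebra_simps)
      also have "\<dots> \<le> ln (1 + s) + ?c - s0 / (1 + s0) * L"
      proof (rule diff_mono)
        show "s / (1 + s) * (d * (u + ?c)) \<le> ln (1 + s) + ?c"
          using d sp by (intro critical_contraction) (auto simp: u_def)
        have "s0 / (1 + s0) \<le> s / (1 + s)" using False s0 sp by (simp add: field_simps)
        then show "s0 / (1 + s0) * L \<le> s / (1 + s) * L" using L by (intro mult_right_mono) auto
      qed
      also have "\<dots> \<le> ln (1 + s) + ?c - \<kappa>" by (simp add: \<kappa>_def)
      finally show ?thesis .
    qed
    then show ?thesis by (simp add: s_def)
  qed
  ultimately show ?thesis using that by blast
qed

section \<open>The recursion at complex arguments\<close>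

text \<open>Keeps the argument of \<open>Ln\<close> off the branch cut: rotating the term
  \<open>s\<close> costs at most the factor \<open>C\<close> against the real value
  \<open>1 + s\<close>.\<close>

lemma norm_one_plus_rotated_ge:
  fixes w :: complex
  assumes l: "l \<ge> 0" and C: "C \<le> cos (d * Im w)" "0 < C" "C \<le> 1"
  defines "s \<equiv> l * exp (- d * Re w)"
  shows "(1 + s) * C \<le> Re (1 + of_real l * exp (- of_real d * w))"
proof -
  have s: "s \<ge> 0" using l by (simp add: s_def)
  have "Re (1 + of_real l * exp (- of_real d * w)) = 1 + s * cos (d * Im w)"
    by (simp add: Re_exp s_def)
  moreover have "s * C \<le> s * cos (d * Im w)" using C s by (intro mult_left_mono)
  ultimately show ?thesis using C(3) by (simp add: algebra_simps)
qed

text \<open>Mean value inequality on the vertical segment from \<open>u\<close> to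
  \<open>Re u\<close>. The modulus of \<open>exp (- d * w)\<close> is constant there, so the
  derivative exceeds the real one, \<open>d * s / (1 + s)\<close>, at most by the factor
  \<open>1 / C\<close>.\<close>

lemma recursion_vertical_bound:
  fixes u :: complex
  assumes l: "l \<ge> 0" and d: "d > 0" and C: "0 < C" "C \<le> 1"
    and cosC: "\<And>t. \<bar>t\<bar> \<le> \<bar>Im u\<bar> \<Longrightarrow> C \<le> cos (d * t)"
  defines "s \<equiv> l * exp (- d * Re u)"
  shows "norm (Ln (1 + of_real l * exp (- of_real d * u)) - of_real (ln (1 + s))) \<le> d * s / (1 + s) / C * \<bar>Im u\<bar>"
proof -
  have s: "s \<ge> 0" using l by (simp add: s_def)
  define S where "S = closed_segment u (of_real (Re u))"
  have S: "Re w = Re u" "\<bar>Im w\<bar> \<le> \<bar>Im u\<bar>" if w: "w \<in> S" for w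
  proof -
    obtain t where t: "0 \<le> t" "t \<le> 1" "w = (1 - t) *\<^sub>R u + t *\<^sub>R of_real (Re u)"
      using w by (auto simp: S_def closed_segment_def)
    have "Re w = (1 - t) * Re u + t * Re u" unfolding t(3) by simp
    then show "Re w = Re u" by (simp add: algebra_simps)
    have "Im w = (1 - t) * Im u" using t by simp
    then show "\<bar>Im w\<bar> \<le> \<bar>Im u\<bar>" using t by (simp add: abs_mult mult_left_le_one_le)
  qed
  have re: "(1 + s) * C \<le> Re (1 + of_real l * exp (- of_real d * w))" if "w \<in> S" for w
    using norm_one_plus_rotated_ge[OF l cosC[OF S(2)[OF that]] C] S(1)[OF that] by (simp add: s_def)
  have pos: "(1 + s) * C > 0" using s C by simp
  let ?f = "\<lambda>w. Ln (1 + of_real l * exp (- of_real d * w))"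
  let ?f' = "\<lambda>w. (- of_real d * of_real l * exp (- of_real d * w)) / (1 + of_real l * exp (- of_real d * w))"
  have "norm (?f u - ?f (of_real (Re u))) \<le> (d * s / (1 + s) / C) * norm (u - of_real (Re u))"
  proof (rule field_differentiable_bound[where S = S and f' = ?f'])
    show "convex S" "u \<in> S" "of_real (Re u) \<in> S" by (auto simp: S_def)
    fix w assume w: "w \<in> S"
    have "1 + of_real l * exp (- of_real d * w) \<notin> \<real>\<^sub>\<le>\<^sub>0"
      using re[OF w] pos by (auto simp: complex_nonpos_Reals_iff)
    then show "(?f has_field_derivative ?f' w) (at w within S)"
      by (auto intro!: derivative_eq_intros simp: field_simps)
    have "norm (exp (- of_real d * w)) = exp (- d * Re u)" using S(1)[OF w] by simp
    then have num: "norm (- of_real d * of_real l * exp (- of_real d * w)) = d * s"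
      using d l by (simp add: norm_mult s_def)
    have "(1 + s) * C \<le> norm (1 + of_real l * exp (- of_real d * w))"
      using re[OF w] complex_Re_le_cmod order_trans by blast
    then have "d * s / norm (1 + of_real l * exp (- of_real d * w)) \<le> d * s / ((1 + s) * C)"
      using pos d s by (intro divide_left_mono mult_pos_pos[OF less_le_trans[OF pos] pos]) auto
    then show "norm (?f' w) \<le> d * s / (1 + s) / C"
      by (simp only: norm_divide num) simp
  qed
  moreover have "?f (of_real (Re u)) = of_real (ln (1 + s))"
  proof -
    have "1 + of_real l * exp (- of_real d * of_real (Re u)) = (of_real (1 + s) :: complex)"
      unfolding s_def by (simp flip: exp_of_real)
    then show ?thesis using s by (simp only: Ln_of_real)
  qed
  moreover have "norm (u - of_real (Re u)) = \<bar>Im u\<bar>"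
    by (metis complex_eq_iff cmod_eq_Im Re_complex_of_real Im_complex_of_real diff_self minus_complex.simps diff_zero)
  ultimately show ?thesis by simp
qed

text \<open>Mean value inequality in the fugacity: on the disc of radius \<open>\<eta>\<close> about
  \<open>l\<close> the real part of \<open>1 + w * q\<close> stays at least \<open>1 / 2\<close>, so
  the derivative \<open>q / (1 + w * q)\<close> of the logarithm is at most
  \<open>2 * norm q\<close>.\<close>

lemma recursion_perturbation_bound:
  fixes q z :: complex
  assumes l: "Re (1 + of_real l * q) \<ge> 1" and q: "norm q * \<eta> \<le> 1 / 2" and z: "norm (z - of_real l) \<le> \<eta>"
  shows "norm (Ln (1 + z * q) - Ln (1 + of_real l * q)) \<le> 2 * norm q * \<eta>"
    and "1 + z * q \<noteq> 0"
proof -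
  define S where "S = cball (complex_of_real l) \<eta>"
  have eta: "\<eta> \<ge> 0" using z norm_ge_zero order_trans by blast
  have re: "1 / 2 \<le> Re (1 + w * q)" if "w \<in> S" for w
  proof -
    have "norm ((w - of_real l) * q) \<le> \<eta> * norm q"
      using that unfolding norm_mult S_def by (intro mult_right_mono) (auto simp: dist_norm norm_minus_commute)
    also have "\<dots> \<le> 1 / 2" using q by (simp add: mult.commute)
    finally have "\<bar>Re ((w - of_real l) * q)\<bar> \<le> 1 / 2" using abs_Re_le_cmod order_trans by blast
    moreover have "Re (1 + w * q) = Re (1 + of_real l * q) + Re ((w - of_real l) * q)"
      by (simp add: algebra_simps)
    ultimately show ?thesis using l by linarith
  qed
  have zS: "z \<in> S" using z by (simp add: S_def dist_norm norm_minus_commute)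
  show "1 + z * q \<noteq> 0" using re[OF zS] by (metis zero_complex.simps(1) not_one_le_zero half_gt_zero_iff zero_less_one linorder_not_le)
  have "norm (Ln (1 + z * q) - Ln (1 + of_real l * q)) \<le> (2 * norm q) * norm (z - of_real l)"
  proof (rule field_differentiable_bound[where S = S and f' = "\<lambda>w. q / (1 + w * q)"])
    show "convex S" "z \<in> S" "of_real l \<in> S" using zS eta by (auto simp: S_def)
    fix w assume w: "w \<in> S"
    have "1 + w * q \<notin> \<real>\<^sub>\<le>\<^sub>0" using re[OF w] by (auto simp: complex_nonpos_Reals_iff)
    then show "((\<lambda>w. Ln (1 + w * q)) has_field_derivative q / (1 + w * q)) (at w within S)"
      by (auto intro!: derivative_eq_intros simp: field_simps)
    have "1 / 2 \<le> norm (1 + w * q)" using re[OF w] complex_Re_le_cmod order_trans by blast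
    then have "norm q / norm (1 + w * q) \<le> norm q / (1 / 2)" by (intro divide_left_mono) auto
    then show "norm (q / (1 + w * q)) \<le> 2 * norm q" by (simp add: norm_divide mult.commute)
  qed
  also have "\<dots> \<le> (2 * norm q) * \<eta>" using z by (intro mult_left_mono) auto
  finally show "norm (Ln (1 + z * q) - Ln (1 + of_real l * q)) \<le> 2 * norm q * \<eta>" .
qed

text \<open>
  The region is a thin trapezoid around a real interval, whose half-width is \<open>\<epsilon> * (x + c)\<close>.
  Its upper and lower sides are segments because the profile is affine, which makes it convex. Only first-order
  bounds are needed: an error \<open>O(\<epsilon>)\<close> in the real part changes the allowed width by \<open>O(\<epsilon>\<^sup>2)\<close> only, less than
  the gap \<open>\<kappa> * \<epsilon>\<close>.
\<close>

lemma invariant_region_exists: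
  fixes d L \<Lambda> :: real
  assumes d: "d > 1" and L: "L > 0" and \<Lambda>: "\<Lambda> > 0"
    and sub: "ln \<Lambda> + L \<le> d * ln d - (d + 1) * ln (d - 1)"
  obtains U :: "complex set" and \<eta> :: real where "\<eta> > 0" "convex U" "0 \<in> U"
    "\<And>u. u \<in> U \<Longrightarrow> Re (exp u) > 1 / 2"
    "\<And>l z u. 0 \<le> l \<Longrightarrow> l \<le> \<Lambda> \<Longrightarrow> norm (z - of_real l) \<le> \<eta> \<Longrightarrow> u \<in> U \<Longrightarrow>
      \<exists>w\<in>U. 1 + z * exp (- of_real d * u) = exp w"
proof -
  define c where "c = region_shift d"
  have c: "c > 0" using region_shift_pos[OF d] by (simp add: c_def)
  \<comment> \<open>\<open>a < c\<close> keeps the width \<open>Re u + c\<close> positive on the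
    region, and \<open>a \<le> 1 / 4\<close> helps to give \<open>Re (exp u) > 1 / 2\<close>
    there.\<close>
  define a where "a = min (c / 2) (1 / 4)"
  have a: "a > 0" "a \<le> 1 / 4" "a < c" using c by (auto simp: a_def)
  \<comment> \<open>\<open>V\<close> bounds the real image \<open>ln (1 + s)\<close> of every point
    with real part at least \<open>- a\<close>; \<open>X = V + 1\<close> leaves room for the
    errors.\<close>
  define V where "V = ln (1 + \<Lambda> * exp (d * a))"
  have V: "V \<ge> 0" using \<Lambda> by (simp add: V_def)
  define X where "X = V + 1"
  define K where "K = V + c"
  define h where "h = X + c"
  have h: "h > 1" using V c by (simp add: h_def X_def)
  obtain \<kappa> where \<kappa>: "\<kappa> > 0"
    and gap: "\<And>l x. 0 \<le> l \<Longrightarrow> (l > 0 \<Longrightarrow> ln l + L \<le> d * ln d - (d + 1) * ln (d - 1)) \<Longrightarrow> x \<le> X \<Longrightarrow>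
      l * exp (- d * x) / (1 + l * exp (- d * x)) * (d * (x + c)) \<le> ln (1 + l * exp (- d * x)) + c - \<kappa>"
    using subcritical_contraction_gap[OF d L, of X] V unfolding X_def c_def by (metis add_nonneg_pos zero_less_one)
  \<comment> \<open>\<open>e\<close> bounds the angle \<open>d * \<bar>Im u\<bar>\<close> on the
    region. The entries \<open>a / 4\<close> and \<open>\<kappa> / 8\<close> control the error in
    the real part, \<open>\<kappa> / (4 * K)\<close> the loss from dividing by
    \<open>C\<close>.\<close>
  define e where "e = Min {1 / 2, \<kappa> / (4 * K), a / 4, \<kappa> / 8}"
  have K: "K > 0" using V c by (simp add: K_def)
  have e: "e > 0" "e \<le> 1 / 2" "e \<le> \<kappa> / (4 * K)" "e \<le> a / 4" "e \<le> \<kappa> / 8"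
    using \<kappa> K a by (auto simp: e_def)
  define \<epsilon> where "\<epsilon> = e / (d * h)"
  have dh: "d * h > 1" using d h by (simp add: less_1_mult)
  have eps: "\<epsilon> > 0" "d * \<epsilon> * h = e" using e dh d h by (auto simp: \<epsilon>_def)
  have eps1: "\<epsilon> * h \<le> 1 / 2" "\<epsilon> \<le> 1"
  proof -
    have "\<epsilon> * h * 1 \<le> \<epsilon> * h * d" using eps h d by (intro mult_left_mono) auto
    then show 1: "\<epsilon> * h \<le> 1 / 2" using eps(2) e(2) by (simp add: mult_ac)
    have "\<epsilon> * 1 \<le> \<epsilon> * h" using eps h by (intro mult_left_mono) auto
    then show "\<epsilon> \<le> 1" using 1 by simp
  qed
  define C where "C = 1 - e\<^sup>2 / 2"
  have e2: "e\<^sup>2 \<le> e" using e by (simp add: power2_eq_square mult_left_le)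
  have C: "1 / 2 \<le> C" "C \<le> 1" "0 < C" using e2 e by (auto simp: C_def)
  have invC: "1 / C \<le> 1 + e"
  proof -
    have "(1 + e) * C = 1 + e - e\<^sup>2 / 2 - e * e\<^sup>2 / 2" by (simp add: C_def algebra_simps)
    moreover have "e * e\<^sup>2 \<le> e * 1" using e e2 by (intro mult_left_mono) auto
    ultimately have "1 \<le> (1 + e) * C" using e2 by simp
    then show ?thesis using C by (simp add: divide_le_eq)
  qed
  \<comment> \<open>\<open>r\<close> is the error allowed for making the fugacity complex. Since
    \<open>exp (d * a)\<close> bounds the norm of \<open>exp (- d * u)\<close> on the region, this
    determines \<open>\<eta>\<close>.\<close>
  define r where "r = Min {1 / 2, a / 2, \<epsilon> * \<kappa> / 4}"
  have r: "r > 0" "r \<le> 1 / 2" "r \<le> a / 2" "r \<le> \<epsilon> * \<kappa> / 4" using a eps \<kappa> by (auto simp: r_def)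
  define \<eta> where "\<eta> = r / (2 * exp (d * a))"
  have eta: "\<eta> > 0" using r by (simp add: \<eta>_def)
  define U where "U = {w. - a \<le> Re w \<and> Re w \<le> X \<and> \<bar>Im w\<bar> \<le> \<epsilon> * (Re w + c)}"
  have UI: "\<bar>Im u\<bar> \<le> \<epsilon> * h" if "u \<in> U" for u
  proof -
    have "\<epsilon> * (Re u + c) \<le> \<epsilon> * h" using that eps by (intro mult_left_mono) (auto simp: U_def h_def)
    then show ?thesis using that by (auto simp: U_def)
  qed
  have "convex U"
    unfolding convex_def
  proof (intro ballI allI impI)
    fix x y :: complex and u v :: real
    assume xy: "x \<in> U" "y \<in> U" and uv: "0 \<le> u" "0 \<le> v" "u + v = 1"
    have 1: "u * (- a) + v * (- a) \<le> u * Re x + v * Re y"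
      using xy uv by (intro add_mono mult_left_mono) (auto simp: U_def)
    have 2: "u * Re x + v * Re y \<le> u * X + v * X"
      using xy uv by (intro add_mono mult_left_mono) (auto simp: U_def)
    have "\<bar>u * Im x + v * Im y\<bar> \<le> u * \<bar>Im x\<bar> + v * \<bar>Im y\<bar>"
      using uv by (intro order_trans[OF abs_triangle_ineq]) (simp add: abs_mult)
    also have "\<dots> \<le> u * (\<epsilon> * (Re x + c)) + v * (\<epsilon> * (Re y + c))"
      using xy uv by (intro add_mono mult_left_mono) (auto simp: U_def)
    also have "\<dots> = \<epsilon> * (u * Re x + v * Re y + (u + v) * c)" by (simp add: algebra_simps)
    finally have 3: "\<bar>u * Im x + v * Im y\<bar> \<le> \<epsilon> * (u * Re x + v * Re y + c)" using uv by simp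
    have "u * (- a) + v * (- a) = - a" "u * X + v * X = X"
      using uv(3) by (metis distrib_right mult_1)+
    then show "u *\<^sub>R x + v *\<^sub>R y \<in> U" using 1 2 3 by (simp add: U_def)
  qed
  moreover have "0 \<in> U" using a V eps c by (simp add: U_def X_def)
  moreover have "Re (exp u) > 1 / 2" if u: "u \<in> U" for u
  proof -
    have "1 - (1 / 4) \<le> 1 + Re u" using u a by (simp add: U_def)
    also have "\<dots> \<le> exp (Re u)" by (rule exp_ge_add_one_self)
    finally have 1: "3 / 4 \<le> exp (Re u)" by simp
    have "\<bar>Im u\<bar> \<le> 1 / 2" using UI[OF u] eps1 by simp
    then have "(Im u)\<^sup>2 \<le> (1 / 2)\<^sup>2" using abs_le_square_iff[of "Im u" "1 / 2"] by simp
    then have "7 / 8 \<le> cos (Im u)" using cos_ge_quadratic[of "Im u"] by (simp add: power2_eq_square)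
    then have "(3 / 4) * (7 / 8) \<le> exp (Re u) * cos (Im u)" using 1 by (intro mult_mono) auto
    then show ?thesis by (simp add: Re_exp)
  qed
  moreover have "\<exists>w\<in>U. 1 + z * exp (- of_real d * u) = exp w"
    if l: "0 \<le> l" "l \<le> \<Lambda>" and z: "norm (z - of_real l) \<le> \<eta>" and u: "u \<in> U" for l z u
  proof -
    define s where "s = l * exp (- d * Re u)"
    have s: "s \<ge> 0" using l by (simp add: s_def)
    define v where "v = ln (1 + s)"
    have v: "v \<ge> 0" using s by (simp add: v_def)
    define q where "q = exp (- complex_of_real d * u)"
    have "d * (- Re u) \<le> d * a" using u d by (intro mult_left_mono) (auto simp: U_def)
    then have dRe: "- (d * Re u) \<le> d * a" by simp
    have qn: "norm q \<le> exp (d * a)" using dRe by (simp add: q_def)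
    have "s \<le> \<Lambda> * exp (d * a)"
      unfolding s_def using l \<Lambda> dRe by (intro mult_mono) auto
    then have vV: "v \<le> V" using s by (simp add: v_def V_def)
    define w0 where "w0 = Ln (1 + of_real l * q)"
    define w where "w = Ln (1 + z * q)"
    have cosC: "C \<le> cos (d * t)" if t: "\<bar>t\<bar> \<le> \<bar>Im u\<bar>" for t
    proof -
      have "\<bar>d * t\<bar> \<le> d * (\<epsilon> * h)"
        unfolding abs_mult using d t UI[OF u] by (intro mult_mono) auto
      then have "(d * t)\<^sup>2 \<le> e\<^sup>2" using eps(2) e(1) by (simp add: abs_le_square_iff[symmetric] mult.assoc)
      then show ?thesis using cos_ge_quadratic[of "d * t"] by (simp add: C_def)
    qed
    have cosCu: "C \<le> cos (d * Im u)" by (rule cosC) simp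
    have n0: "norm (w0 - of_real v) \<le> d * s / (1 + s) / C * \<bar>Im u\<bar>"
      using recursion_vertical_bound[OF l(1) _ C(3,2) cosC] d by (simp add: w0_def q_def v_def s_def)
    have "Re (1 + of_real l * q) = 1 + s * cos (d * Im u)" by (simp add: Re_exp s_def q_def)
    then have re: "Re (1 + of_real l * q) \<ge> 1" using s cosCu C by simp
    have qeta: "2 * norm q * \<eta> \<le> r"
    proof -
      have "2 * norm q * \<eta> \<le> 2 * exp (d * a) * \<eta>" using qn eta by (intro mult_right_mono) auto
      then show ?thesis by (simp add: \<eta>_def)
    qed
    have qeta': "norm q * \<eta> \<le> 1 / 2" using qeta r by simp
    have n1: "norm (w - w0) \<le> r" and nz: "1 + z * q \<noteq> 0"
      using recursion_perturbation_bound[OF re qeta' z] qeta by (auto simp: w_def w0_def)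
    have xc: "Re u + c > 0" using u a by (auto simp: U_def)
    have Bd: "d * s / (1 + s) \<le> d"
      using s d by (simp add: divide_le_eq mult_left_mono)
    have "d * s / (1 + s) / C * \<bar>Im u\<bar> \<le> d * 2 * (\<epsilon> * h)"
    proof (rule mult_mono)
      have "d * s / (1 + s) / C \<le> d / (1 / 2)" using Bd C d s by (intro frac_le) auto
      then show "d * s / (1 + s) / C \<le> d * 2" by simp
    qed (use UI[OF u] d in auto)
    then have n0': "norm (w0 - of_real v) \<le> 2 * e" using n0 eps(2) by simp
    have Rew: "\<bar>Re w - v\<bar> \<le> 2 * e + r"
    proof -
      have "\<bar>Re (w0 - of_real v)\<bar> \<le> 2 * e" using n0' abs_Re_le_cmod order_trans by blast
      moreover have "\<bar>Re (w - w0)\<bar> \<le> r" using n1 abs_Re_le_cmod order_trans by blast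
      ultimately show ?thesis by simp
    qed
    have lnl: "ln l + L \<le> d * ln d - (d + 1) * ln (d - 1)" if "l > 0"
    proof -
      have "ln l \<le> ln \<Lambda>" using that l by simp
      then show ?thesis using sub by linarith
    qed
    have g: "s / (1 + s) * (d * (Re u + c)) \<le> v + c - \<kappa>"
      using gap[OF l(1) lnl, of "Re u"] u by (simp add: s_def v_def U_def)
    \<comment> \<open>The gap \<open>\<kappa>\<close> is spent in three portions: a quarter on the
      factor \<open>1 / C\<close>, a quarter on the perturbation \<open>r\<close>, and half on
      replacing \<open>v\<close> by \<open>Re w\<close>.\<close>
    have "d * s / (1 + s) / C * \<bar>Im u\<bar> \<le> d * s / (1 + s) / C * (\<epsilon> * (Re u + c))"
      using u s d C by (intro mult_left_mono) (auto simp: U_def)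
    also have "\<dots> = \<epsilon> * ((s / (1 + s) * (d * (Re u + c))) * (1 / C))" by (simp add: mult_ac)
    also have "\<dots> \<le> \<epsilon> * ((s / (1 + s) * (d * (Re u + c))) * (1 + e))"
      using invC eps s d xc by (intro mult_left_mono) auto
    also have "\<dots> \<le> \<epsilon> * ((v + c - \<kappa>) * (1 + e))"
      using g eps e by (intro mult_left_mono mult_right_mono) auto
    also have "\<dots> \<le> \<epsilon> * (v + c - 3 * \<kappa> / 4)"
    proof (rule mult_left_mono)
      have "(v + c - \<kappa>) * e \<le> K * e" using vV \<kappa> e by (intro mult_right_mono) (auto simp: K_def)
      also have "\<dots> \<le> \<kappa> / 4" using e(3) K by (simp add: pos_le_divide_eq mult_ac)
      finally show "(v + c - \<kappa>) * (1 + e) \<le> v + c - 3 * \<kappa> / 4" by (simp add: algebra_simps)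
    qed (use eps in auto)
    finally have "norm (w0 - of_real v) \<le> \<epsilon> * (v + c - 3 * \<kappa> / 4)" using n0 by linarith
    then have "\<bar>Im (w0 - of_real v)\<bar> \<le> \<epsilon> * (v + c - 3 * \<kappa> / 4)" using abs_Im_le_cmod order_trans by blast
    moreover have "\<bar>Im (w - w0)\<bar> \<le> r" using n1 abs_Im_le_cmod order_trans by blast
    ultimately have "\<bar>Im w\<bar> \<le> \<epsilon> * (v + c - 3 * \<kappa> / 4) + r" by simp
    also have "\<dots> \<le> \<epsilon> * (v + c - 3 * \<kappa> / 4) + \<epsilon> * \<kappa> / 4" using r by simp
    also have "\<dots> = \<epsilon> * (v + c - \<kappa> / 2)" by (simp add: algebra_simps)
    also have "\<dots> \<le> \<epsilon> * (Re w + c)"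
    proof (rule mult_left_mono)
      have "\<epsilon> * \<kappa> \<le> 1 * \<kappa>" using eps1 \<kappa> by (intro mult_right_mono) auto
      then have "2 * e + r \<le> \<kappa> / 2" using e(5) r(4) by simp
      then show "v + c - \<kappa> / 2 \<le> Re w + c" using Rew by linarith
    qed (use eps in auto)
    finally have "\<bar>Im w\<bar> \<le> \<epsilon> * (Re w + c)" .
    moreover have "- a \<le> Re w" using Rew v e(4) r(3) by linarith
    moreover have "Re w \<le> X" using Rew vV e(4) r(3) a unfolding X_def by linarith
    ultimately have "w \<in> U" by (simp add: U_def)
    moreover have "exp w = 1 + z * exp (- of_real d * u)" using nz by (simp add: w_def q_def)
    ultimately show ?thesis by metis
  qed
  ultimately show ?thesis using that eta by blast
qed

section \<open>Zero-freeness below the critical fugacity\<close>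

text \<open>The average of the values lies in \<open>U\<close>. Shrinking it towards
  \<open>0\<close> by \<open>card N / d\<close> stays in \<open>U\<close> and turns a sum of
  \<open>card N\<close> terms into \<open>d\<close> equal ones.\<close>

lemma sum_in_scaled_convex:
  fixes U :: "'a::real_vector set"
  assumes "convex U" "0 \<in> U" "\<And>x. x \<in> N \<Longrightarrow> f x \<in> U" "card N \<le> d" "d > 0"
  obtains u where "u \<in> U" "sum f N = real d *\<^sub>R u"
proof (cases "card N = 0")
  case True
  then have "sum f N = 0" by (auto simp: card_eq_0_iff)
  then show ?thesis using that[of 0] assms by simp
next
  case False
  then have fin: "finite N" by (meson card.infinite)
  define m where "m = (\<Sum>x\<in>N. (1 / real (card N)) *\<^sub>R f x)"
  have m: "m \<in> U"
    unfolding m_def using fin False assms by (intro convex_sum) auto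
  define t where "t = real (card N) / real d"
  have "t *\<^sub>R m + (1 - t) *\<^sub>R 0 \<in> U"
    using assms m by (intro convexD) (auto simp: t_def)
  moreover have "sum f N = real d *\<^sub>R (t *\<^sub>R m)"
    using False assms(5) by (simp add: t_def m_def flip: scaleR_sum_right)
  ultimately show ?thesis using that[of "t *\<^sub>R m"] by simp
qed

text \<open>Delete the vertices of \<open>N\<close> one at a time and multiply the ratios. Written
  as exponentials of elements of \<open>U\<close>, they combine by adding exponents, with no choice
  of branch.\<close>

lemma indep_poly_telescope:
  fixes z :: complex
  assumes "finite N"
    and "\<And>M x. M \<subseteq> N \<Longrightarrow> x \<in> N - M \<Longrightarrow> \<exists>w\<in>U. indep_poly E (A - M) z = exp w * indep_poly E (A - insert x M) z"
  shows "\<exists>f. (\<forall>x\<in>N. f x \<in> U) \<and> indep_poly E A z = exp (sum f N) * indep_poly E (A - N) z"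
  using assms
proof (induction N rule: finite_induct)
  case (insert x N)
  have "\<exists>f. (\<forall>x\<in>N. f x \<in> U) \<and> indep_poly E A z = exp (sum f N) * indep_poly E (A - N) z"
    by (rule insert.IH) (use insert.prems in blast)
  then obtain f where f: "\<forall>x\<in>N. f x \<in> U" "indep_poly E A z = exp (sum f N) * indep_poly E (A - N) z"
    by blast
  obtain w where w: "w \<in> U" "indep_poly E (A - N) z = exp w * indep_poly E (A - insert x N) z"
    using insert.prems[of N x] insert.hyps by blast
  have "sum (f(x := w)) (insert x N) = w + sum f N"
    using insert.hyps by (simp add: sum.insert) (intro sum.cong, auto)
  then have "indep_poly E A z = exp (sum (f(x := w)) (insert x N)) * indep_poly E (A - insert x N) z"
    using f(2) w(2) by (simp add: exp_add)
  then show ?case using f(1) w(1) by (intro exI[of _ "f(x := w)"]) auto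
qed simp

text \<open>
  Once \<open>v\<close> is deleted, each of its neighbours has at most \<open>d\<close> neighbours left, so deleting the neighbours one
  at a time costs factors \<open>exp u\<close> with \<open>u \<in> U\<close>. By convexity, at most \<open>d\<close> such factors multiply to
  \<open>exp (d * u)\<close> with a single \<open>u \<in> U\<close>. A vertex with \<open>d + 1\<close> neighbours leaves one extra factor, which the
  condition \<open>Re (exp u) > 1 / 2\<close> takes care of.
\<close>

lemma indep_poly_zero_free_strong:
  fixes z :: complex and d :: nat
  assumes "sym E" "irrefl E" "d > 0"
    and fin: "\<And>v. finite (E `` {v})" and deg: "\<And>v. card (E `` {v}) \<le> d + 1"
    and U: "convex U" "0 \<in> U" "\<And>u. u \<in> U \<Longrightarrow> Re (exp u) > 1 / 2"
    and z: "\<And>u. u \<in> U \<Longrightarrow> \<exists>w\<in>U. 1 + z * exp (- of_nat d * u) = exp w"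
    and "finite A"
  shows "indep_poly E A z \<noteq> 0 \<and>
    (\<forall>v\<in>A. card (E `` {v} \<inter> A) \<le> d \<longrightarrow> (\<exists>w\<in>U. indep_poly E A z = exp w * indep_poly E (A - {v}) z))"
  using \<open>finite A\<close>
proof (induction A rule: finite_psubset_induct)
  case (psubset A)
  let ?Z = "\<lambda>A. indep_poly E A z"
  have nbr: "\<exists>w\<in>U. ?Z (A - {v} - M) = exp w * ?Z (A - {v} - insert x M)"
    if "v \<in> A" "x \<in> E `` {v} \<inter> A - M" for v x M
  proof -
    have xv: "(x, v) \<in> E" "x \<noteq> v" using that assms(1,2) by (auto dest: symD simp: irrefl_def)
    have "card (E `` {x} \<inter> (A - {v} - M)) \<le> card (E `` {x} - {v})"
      using fin by (intro card_mono) auto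
    also have "\<dots> \<le> d" using deg[of x] xv fin[of x] by simp
    finally have "card (E `` {x} \<inter> (A - {v} - M)) \<le> d" .
    moreover have "A - {v} - M \<subset> A" "x \<in> A - {v} - M" using that xv by auto
    ultimately have "\<exists>w\<in>U. ?Z (A - {v} - M) = exp w * ?Z (A - {v} - M - {x})"
      using psubset.IH by blast
    moreover have "A - {v} - M - {x} = A - {v} - insert x M" by blast
    ultimately show ?thesis by simp
  qed
  have rec: "?Z A = ?Z (A - {v}) + z * ?Z (A - {v} - (E `` {v} \<inter> A))" if "v \<in> A" for v
  proof -
    have "A - insert v (E `` {v}) = A - {v} - (E `` {v} \<inter> A)" by blast
    then show ?thesis
      using indep_poly_rec[OF psubset.hyps that assms(1), of z] assms(2) by (simp add: irrefl_def)
  qed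
  have IHnz: "?Z B \<noteq> 0" if "B \<subset> A" for B using psubset.IH[OF that] by blast
  have low: "\<exists>w\<in>U. ?Z A = exp w * ?Z (A - {v})" if v: "v \<in> A" "card (E `` {v} \<inter> A) \<le> d" for v
  proof -
    let ?N = "E `` {v} \<inter> A"
    obtain f where f: "\<forall>x\<in>?N. f x \<in> U" "?Z (A - {v}) = exp (sum f ?N) * ?Z (A - {v} - ?N)"
      using indep_poly_telescope[of ?N U E "A - {v}" z] nbr[OF v(1)] fin by blast
    obtain u where u: "u \<in> U" "sum f ?N = real d *\<^sub>R u"
      using sum_in_scaled_convex[OF U(1,2), of ?N f d] f(1) v(2) assms(3) by blast
    obtain w where w: "w \<in> U" "1 + z * exp (- of_nat d * u) = exp w" using z u by blast
    have "?Z (A - {v} - ?N) = exp (- of_nat d * u) * ?Z (A - {v})"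
      unfolding f(2) u(2) by (simp add: scaleR_conv_of_real exp_minus field_simps)
    then have "?Z A = (1 + z * exp (- of_nat d * u)) * ?Z (A - {v})"
      using rec[OF v(1)] by (simp add: algebra_simps)
    then show ?thesis using w by auto
  qed
  have "?Z A \<noteq> 0"
  proof (cases "A = {}")
    case False
    then obtain v where v: "v \<in> A" by blast
    let ?N = "E `` {v} \<inter> A"
    show ?thesis
    proof (cases "card ?N \<le> d")
      case True
      then obtain w where "?Z A = exp w * ?Z (A - {v})" using low v by blast
      moreover have "?Z (A - {v}) \<noteq> 0" using v by (intro IHnz) blast
      ultimately show ?thesis by simp
    next
      case False
      \<comment> \<open>With \<open>d + 1\<close> neighbours, \<open>x\<close> is set aside: the
        other \<open>d\<close> fit the averaging argument, and deleting \<open>x\<close> last costs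
        the extra factor \<open>exp y\<close>.\<close>
      then obtain x where x: "x \<in> ?N" by (metis card.empty equals0I zero_le)
      let ?M = "?N - {x}"
      have cardM: "card ?M \<le> d"
      proof -
        have "card ?N \<le> d + 1"
          using card_mono[OF fin[of v], of ?N] deg[of v] by simp
        then show ?thesis using x fin[of v] by simp
      qed
      obtain f where f: "\<forall>x\<in>?M. f x \<in> U" "?Z (A - {v}) = exp (sum f ?M) * ?Z (A - {v} - ?M)"
        using indep_poly_telescope[of ?M U E "A - {v}" z] nbr[OF v] fin by blast
      obtain u where u: "u \<in> U" "sum f ?M = real d *\<^sub>R u"
        using sum_in_scaled_convex[OF U(1,2), of ?M f d] f(1) cardM assms(3) by blast
      obtain w where w: "w \<in> U" "1 + z * exp (- of_nat d * u) = exp w" using z u by blast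
      have "insert x ?M = ?N" using x by blast
      then obtain y where y: "y \<in> U" "?Z (A - {v} - ?M) = exp y * ?Z (A - {v} - ?N)"
        using nbr[OF v, of x ?M] x by auto
      define Z0 where "Z0 = ?Z (A - {v} - ?N)"
      have "?Z A = exp (of_nat d * u) * (exp y * Z0) + z * Z0"
        unfolding rec[OF v] f(2) u(2) y(2) Z0_def by (simp add: scaleR_conv_of_real)
      \<comment> \<open>The equation for \<open>w\<close> is solved for \<open>z\<close>, so that
        both terms share the factor \<open>exp (of_nat d * u)\<close>.\<close>
      also have "z * Z0 = exp (of_nat d * u) * (exp w - 1) * Z0"
        by (rule arg_cong[where f = "\<lambda>x. x * Z0"]) (use w(2) in \<open>simp add: exp_minus field_simps\<close>)
      finally have "?Z A = exp (of_nat d * u) * (exp y + exp w - 1) * Z0"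
        by (simp add: algebra_simps)
      moreover have "exp y + exp w - 1 \<noteq> 0"
      proof -
        have "Re (exp y + exp w - 1) > 0" using U(3)[OF y(1)] U(3)[OF w(1)] by simp
        then show ?thesis by (metis less_irrefl zero_complex.simps(1))
      qed
      moreover have "Z0 \<noteq> 0" unfolding Z0_def using v by (intro IHnz) blast
      ultimately show ?thesis by simp
    qed
  qed simp
  then show ?case using low by blast
qed

text \<open>The radius \<open>\<eta>\<close> comes from the invariant region, hence depends on
  \<open>d\<close>, \<open>L\<close> and \<open>\<Lambda>\<close> but not on the graph. The
  hypothesis on \<open>ln \<Lambda>\<close> puts \<open>\<Lambda>\<close> below
  \<open>d ^ d / (d - 1) ^ (d + 1)\<close> by at least the factor \<open>exp (- L)\<close>.\<close>

lemma indep_poly_zero_free: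
  fixes d :: nat and L \<Lambda> :: real
  assumes d: "d > 1" and L: "L > 0" and \<Lambda>: "\<Lambda> > 0"
    and sub: "ln \<Lambda> + L \<le> d * ln d - (d + 1) * ln (d - 1)"
  obtains \<eta> :: real where "\<eta> > 0"
    "\<And>(E :: 'a rel) A l z. sym E \<Longrightarrow> irrefl E \<Longrightarrow> (\<And>v. finite (E `` {v})) \<Longrightarrow>
       (\<And>v. card (E `` {v}) \<le> d + 1) \<Longrightarrow> finite A \<Longrightarrow> 0 \<le> l \<Longrightarrow> l \<le> \<Lambda> \<Longrightarrow>
       norm (z - complex_of_real l) \<le> \<eta> \<Longrightarrow> indep_poly E A z \<noteq> 0"
proof -
  have sub': "ln \<Lambda> + L \<le> real d * ln (real d) - (real d + 1) * ln (real d - 1)"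
    using sub d by (simp add: of_nat_diff add.commute)
  obtain U :: "complex set" and \<eta> :: real where U: "\<eta> > 0" "convex U" "0 \<in> U"
    "\<And>u. u \<in> U \<Longrightarrow> Re (exp u) > 1 / 2"
    "\<And>l z u. 0 \<le> l \<Longrightarrow> l \<le> \<Lambda> \<Longrightarrow> norm (z - of_real l) \<le> \<eta> \<Longrightarrow> u \<in> U \<Longrightarrow>
      \<exists>w\<in>U. 1 + z * exp (- of_real (real d) * u) = exp w"
    by (rule invariant_region_exists[OF _ L \<Lambda> sub']) (use d in simp, blast)
  have "indep_poly E A z \<noteq> 0"
    if "sym E" "irrefl E" "\<And>v. finite (E `` {v})" "\<And>v. card (E `` {v}) \<le> d + 1"
      "finite A" "0 \<le> l" "l \<le> \<Lambda>" "norm (z - complex_of_real l) \<le> \<eta>" for E :: "'a rel" and A l z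
  proof -
    have "\<exists>w\<in>U. 1 + z * exp (- of_nat d * u) = exp w" if "u \<in> U" for u
      using U(5)[OF \<open>0 \<le> l\<close> \<open>l \<le> \<Lambda>\<close> \<open>norm (z - complex_of_real l) \<le> \<eta>\<close> that] by simp
    then show ?thesis
      using indep_poly_zero_free_strong[of E d U z A] that U d by simp
  qed
  then show ?thesis using that[of \<eta>] U(1) by blast
qed

section \<open>Factorization over the zeros\<close>

text \<open>Split the polynomial over its complex zeros and recentre at \<open>l\<close>: a zero
  \<open>r\<close> contributes \<open>1 + a * y\<close> with \<open>a = l / (l - r)\<close>, and the
  zero-free disc keeps the denominator above \<open>\<eta>\<close> in norm.\<close>

lemma indep_poly_factorization:
  fixes E :: "'a rel" and l \<eta> :: real
  assumes V: "finite V" and l: "l \<ge> 0" and eta: "\<eta> > 0"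
    and zf: "\<And>z. norm (z - complex_of_real l) \<le> \<eta> \<Longrightarrow> indep_poly E V z \<noteq> 0"
  obtains as :: "complex list" where "length as \<le> card V" "\<And>a. a \<in> set as \<Longrightarrow> norm a \<le> l / \<eta>"
    "\<And>y. indep_poly E V (of_real l * (1 + y)) = indep_poly E V (of_real l) * (\<Prod>a\<leftarrow>as. 1 + a * y)"
proof -
  define P :: "complex poly" where "P = (\<Sum>I\<in>stable_sets E V. monom 1 (card I))"
  have P: "poly P z = indep_poly E V z" for z
    by (simp add: P_def indep_poly_def poly_sum poly_monom)
  have "degree P \<le> card V"
    unfolding P_def
  proof (rule degree_sum_le)
    show "finite (stable_sets E V)" using V by (rule finite_stable_sets)
    fix I assume "I \<in> stable_sets E V"
    then have "card I \<le> card V" using V by (auto simp: stable_sets_def intro: card_mono)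
    then show "degree (monom (1::complex) (card I)) \<le> card V" by (simp add: degree_monom_eq)
  qed
  obtain rs where rs: "mset rs = proots P" using ex_mset by blast
  have "P \<noteq> 0" using P[of "of_real l"] zf[of "of_real l"] eta by auto
  have fact: "poly P z = lead_coeff P * (\<Prod>r\<leftarrow>rs. z - r)" for z
  proof -
    have "P = smult (lead_coeff P) (\<Prod>r\<leftarrow>rs. [:- r, 1:])"
      using complex_poly_decompose_multiset[of P] unfolding rs[symmetric] by (metis mset_map prod_mset_prod_list)
    then have "poly P z = lead_coeff P * poly (\<Prod>r\<leftarrow>rs. [:- r, 1:]) z" by (metis poly_smult)
    also have "poly (\<Prod>r\<leftarrow>rs. [:- r, 1:]) z = (\<Prod>r\<leftarrow>rs. z - r)"
      by (induction rs) (auto simp: algebra_simps)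
    finally show ?thesis .
  qed
  have far: "norm (of_real l - r) > \<eta>" if "r \<in> set rs" for r
  proof (rule ccontr)
    assume "\<not> ?thesis"
    then have "indep_poly E V r \<noteq> 0" by (intro zf) (simp add: norm_minus_commute)
    moreover have "poly P r = 0" using that by (auto simp: fact prod_list_zero_iff)
    ultimately show False using P by simp
  qed
  define as where "as = map (\<lambda>r. of_real l / (of_real l - r)) rs"
  have prod: "(\<Prod>r\<leftarrow>rs. of_real l * (1 + y) - r) = (\<Prod>r\<leftarrow>rs. of_real l - r) * (\<Prod>a\<leftarrow>as. 1 + a * y)" for y
    using far unfolding as_def
  proof (induction rs)
    case (Cons r rs)
    have "of_real l - r \<noteq> 0" using Cons.prems[of r] eta by auto
    then have "of_real l * (1 + y) - r = (of_real l - r) * (1 + of_real l / (of_real l - r) * y)"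
      by (simp add: field_simps)
    then show ?case using Cons by (simp add: mult_ac)
  qed simp
  show ?thesis
  proof (rule that)
    have "length rs = degree P" using rs by (metis size_mset size_proots_complex)
    then show "length as \<le> card V" using \<open>degree P \<le> card V\<close> by (simp add: as_def)
    show "norm a \<le> l / \<eta>" if a: "a \<in> set as" for a
    proof -
      obtain r where r: "r \<in> set rs" "a = of_real l / (of_real l - r)" using a by (auto simp: as_def)
      then have "norm a = l / norm (of_real l - r)" using l by (simp add: norm_divide)
      also have "\<dots> \<le> l / \<eta>" using far[OF r(1)] eta l by (intro divide_left_mono mult_pos_pos) auto
      finally show ?thesis .
    qed
    show "indep_poly E V (of_real l * (1 + y)) = indep_poly E V (of_real l) * (\<Prod>a\<leftarrow>as. 1 + a * y)" for y
      unfolding P[symmetric] fact prod by simp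
  qed
qed

section \<open>The characteristic function near the origin\<close>

text \<open>The derivative of the difference is \<open>v\<^sup>2 / (1 + v)\<close>, and
  \<open>norm (1 + v) \<ge> 1 / 2\<close> on the disc; apply the mean value inequality.\<close>

lemma norm_Ln_quadratic_le:
  assumes "norm w \<le> 1 / 2"
  shows "norm (Ln (1 + w) - (w - w\<^sup>2 / 2)) \<le> 2 * norm w ^ 3"
proof -
  let ?f = "\<lambda>w. Ln (1 + w) - (w - w\<^sup>2 / 2)"
  let ?S = "cball 0 (norm w) :: complex set"
  have "norm (?f w - ?f 0) \<le> (2 * (norm w)\<^sup>2) * norm (w - 0)"
  proof (rule field_differentiable_bound[where S = ?S and f' = "\<lambda>v. v\<^sup>2 / (1 + v)"])
    fix v assume v: "v \<in> ?S"
    then have vw: "norm v \<le> norm w" by simp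
    have re: "1 / 2 \<le> Re (1 + v)" using abs_Re_le_cmod[of v] vw assms by simp
    then have nn: "1 + v \<notin> \<real>\<^sub>\<le>\<^sub>0" "1 + v \<noteq> 0" by (auto simp: complex_nonpos_Reals_iff complex_eq_iff)
    have "1 / (1 + v) - (1 - v) = v\<^sup>2 / (1 + v)" using nn(2) by (simp add: field_simps power2_eq_square)
    moreover have "(?f has_field_derivative 1 / (1 + v) - (1 - v)) (at v within ?S)"
      using nn by (auto intro!: derivative_eq_intros simp: inverse_eq_divide)
    ultimately show "(?f has_field_derivative v\<^sup>2 / (1 + v)) (at v within ?S)" by simp
    have "1 / 2 \<le> norm (1 + v)" using re complex_Re_le_cmod order_trans by blast
    then have "(norm v)\<^sup>2 / norm (1 + v) \<le> (norm w)\<^sup>2 / (1 / 2)"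
      using vw by (intro frac_le power_mono) auto
    then show "norm (v\<^sup>2 / (1 + v)) \<le> 2 * (norm w)\<^sup>2" by (simp add: norm_divide norm_power)
  qed auto
  then show ?thesis by (simp add: power2_eq_square power3_eq_cube)
qed

text \<open>Insert the Taylor expansion of \<open>iexp t\<close> into that of the logarithm. Every
  remainder keeps one factor \<open>norm a\<close>, further ones being bounded by \<open>K\<close>;
  this linear dependence makes the total error over all factors proportional to
  \<open>n * l\<close>.\<close>

lemma iexp_factor_expansion:
  fixes a :: complex and t K :: real
  assumes a: "norm a \<le> K" and t: "\<bar>t\<bar> \<le> 1" "K * \<bar>t\<bar> \<le> 1 / 2"
  obtains r where "norm r \<le> (1 + K + 2 * K\<^sup>2) * norm a * \<bar>t\<bar> ^ 3"
    "1 + a * (iexp t - 1) = exp (\<i> * t * a - (a - a\<^sup>2) * t\<^sup>2 / 2 + r)"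
proof -
  \<comment> \<open>\<open>e2\<close> and \<open>e3\<close> are the remainders of
    \<open>iexp t\<close> after the linear and the quadratic term. Below, \<open>r1\<close> is the
    error of the logarithm and \<open>r2\<close> that of the substitution.\<close>
  define e2 where "e2 = iexp t - 1 - \<i> * t"
  define e3 where "e3 = e2 + t\<^sup>2 / 2"
  define w where "w = a * (iexp t - 1)"
  have K: "K \<ge> 0" using a norm_ge_zero order_trans by blast
  have b1: "norm (iexp t - 1) \<le> \<bar>t\<bar>" using iexp_approx1[of t 0] by simp
  have b2: "norm e2 \<le> t\<^sup>2 / 2"
    using iexp_approx1[of t 1] by (simp add: e2_def numeral_eq_Suc algebra_simps)
  have b3: "norm e3 \<le> \<bar>t\<bar> ^ 3 / 6"
    using iexp_approx1[of t 2] by (simp add: e3_def e2_def numeral_eq_Suc algebra_simps)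
  have w: "norm w \<le> norm a * \<bar>t\<bar>" unfolding w_def norm_mult using b1 by (intro mult_left_mono) auto
  also have "\<dots> \<le> K * \<bar>t\<bar>" using a by (intro mult_right_mono) auto
  finally have wh: "norm w \<le> 1 / 2" using t by simp
  define r1 where "r1 = Ln (1 + w) - (w - w\<^sup>2 / 2)"
  define r2 where "r2 = a * e3 - a\<^sup>2 * (2 * \<i> * t * e2 + e2\<^sup>2) / 2"
  have r1: "norm r1 \<le> 2 * K\<^sup>2 * norm a * \<bar>t\<bar> ^ 3"
  proof -
    have "norm r1 \<le> 2 * norm w ^ 3" using norm_Ln_quadratic_le[OF wh] by (simp add: r1_def)
    also have "\<dots> \<le> 2 * (norm a * \<bar>t\<bar>) ^ 3" using w by (intro mult_left_mono power_mono) auto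
    also have "\<dots> = 2 * ((norm a)\<^sup>2 * (norm a * \<bar>t\<bar> ^ 3))" by (simp add: power2_eq_square power3_eq_cube)
    also have "\<dots> \<le> 2 * (K\<^sup>2 * (norm a * \<bar>t\<bar> ^ 3))"
      using a by (intro mult_left_mono mult_right_mono power_mono) auto
    finally show ?thesis by (simp add: mult_ac)
  qed
  have r2: "norm r2 \<le> (1 + K) * norm a * \<bar>t\<bar> ^ 3"
  proof -
    have sq: "norm (2 * \<i> * t * e2 + e2\<^sup>2) \<le> 2 * \<bar>t\<bar> ^ 3"
    proof -
      have "norm (2 * \<i> * t * e2 + e2\<^sup>2) \<le> 2 * \<bar>t\<bar> * norm e2 + norm e2 * norm e2"
        by (intro order_trans[OF norm_triangle_ineq]) (simp add: norm_mult power2_eq_square)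
      also have "\<dots> \<le> 2 * \<bar>t\<bar> * (t\<^sup>2 / 2) + t\<^sup>2 / 2 * (t\<^sup>2 / 2)"
        using b2 by (intro add_mono mult_left_mono mult_mono) auto
      also have "\<dots> = \<bar>t\<bar> ^ 3 + \<bar>t\<bar> ^ 3 * \<bar>t\<bar> / 4"
        by (simp add: power3_eq_cube power2_eq_square abs_mult_self_eq mult.assoc)
      also have "\<bar>t\<bar> ^ 3 * \<bar>t\<bar> \<le> \<bar>t\<bar> ^ 3 * 1" using t by (intro mult_left_mono) auto
      finally show ?thesis using zero_le_power[of "\<bar>t\<bar>" 3] by linarith
    qed
    have "norm r2 \<le> norm a * norm e3 + (norm a)\<^sup>2 * norm (2 * \<i> * t * e2 + e2\<^sup>2) / 2"
      unfolding r2_def by (intro order_trans[OF norm_triangle_ineq4]) (simp add: norm_mult norm_divide norm_power)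
    also have "\<dots> \<le> norm a * (\<bar>t\<bar> ^ 3 / 6) + (K * norm a) * (2 * \<bar>t\<bar> ^ 3) / 2"
    proof (intro add_mono divide_right_mono mult_mono)
      show "(norm a)\<^sup>2 \<le> K * norm a" using a by (simp add: power2_eq_square mult_right_mono)
    qed (use b3 sq K in auto)
    also have "\<dots> \<le> (1 + K) * norm a * \<bar>t\<bar> ^ 3" by (simp add: algebra_simps)
    finally show ?thesis .
  qed
  have "1 + w \<noteq> 0"
    using wh by (metis add_eq_0_iff norm_minus_cancel norm_one half_bounded_equal linorder_not_le one_less_numeral_iff semiring_norm(76) divide_less_eq_1_pos zero_less_numeral)
  then have "1 + w = exp (Ln (1 + w))" by simp
  also have "Ln (1 + w) = w - w\<^sup>2 / 2 + r1" by (simp add: r1_def)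
  also have "w - w\<^sup>2 / 2 = \<i> * t * a - (a - a\<^sup>2) * t\<^sup>2 / 2 + r2"
  proof -
    have w2: "w = a * (\<i> * t + e2)" by (simp add: w_def e2_def)
    have A: "w = \<i> * t * a - a * t\<^sup>2 / 2 + a * e3" by (simp add: w2 e3_def algebra_simps)
    have B: "w\<^sup>2 = - (a\<^sup>2 * t\<^sup>2) + a\<^sup>2 * (2 * \<i> * t * e2 + e2\<^sup>2)"
      unfolding w2 by (simp add: power2_eq_square algebra_simps)
    show ?thesis
      unfolding r2_def by (subst B, subst A) (simp add: algebra_simps add_divide_distrib diff_divide_distrib)
  qed
  finally have eq: "1 + a * (iexp t - 1) = exp (\<i> * t * a - (a - a\<^sup>2) * t\<^sup>2 / 2 + (r2 + r1))"
    by (simp add: w_def add.assoc)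
  have "norm (r2 + r1) \<le> (1 + K + 2 * K\<^sup>2) * norm a * \<bar>t\<bar> ^ 3"
    by (intro order_trans[OF norm_triangle_ineq] order_trans[OF add_mono[OF r2 r1]]) (simp add: algebra_simps)
  then show ?thesis using eq that by blast
qed

text \<open>Multiply the factors and add the exponents; no logarithm of the product is taken, so
  branches cause no difficulty.\<close>

lemma iexp_prod_expansion:
  fixes as :: "complex list" and t K b :: real
  assumes "\<And>a. a \<in> set as \<Longrightarrow> norm a \<le> b" and b: "b \<le> K" and t: "\<bar>t\<bar> \<le> 1" "K * \<bar>t\<bar> \<le> 1 / 2"
  shows "\<exists>r. norm r \<le> real (length as) * ((1 + K + 2 * K\<^sup>2) * b * \<bar>t\<bar> ^ 3) \<and>
    (\<Prod>a\<leftarrow>as. 1 + a * (iexp t - 1)) = exp (\<i> * t * (\<Sum>a\<leftarrow>as. a) - (\<Sum>a\<leftarrow>as. a - a\<^sup>2) * t\<^sup>2 / 2 + r)"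
  using assms(1)
proof (induction as)
  case (Cons a as)
  obtain r where r: "norm r \<le> real (length as) * ((1 + K + 2 * K\<^sup>2) * b * \<bar>t\<bar> ^ 3)"
    "(\<Prod>a\<leftarrow>as. 1 + a * (iexp t - 1)) = exp (\<i> * t * (\<Sum>a\<leftarrow>as. a) - (\<Sum>a\<leftarrow>as. a - a\<^sup>2) * t\<^sup>2 / 2 + r)"
    using Cons by auto
  have ab: "norm a \<le> b" using Cons.prems by simp
  then have aK: "norm a \<le> K" using b by simp
  have K: "K \<ge> 0" using aK norm_ge_zero order_trans by blast
  obtain r' where r': "norm r' \<le> (1 + K + 2 * K\<^sup>2) * norm a * \<bar>t\<bar> ^ 3"
    "1 + a * (iexp t - 1) = exp (\<i> * t * a - (a - a\<^sup>2) * t\<^sup>2 / 2 + r')"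
    using iexp_factor_expansion[OF aK t] .
  have "(1 + K + 2 * K\<^sup>2) * norm a * \<bar>t\<bar> ^ 3 \<le> (1 + K + 2 * K\<^sup>2) * b * \<bar>t\<bar> ^ 3"
    using ab K by (intro mult_right_mono mult_left_mono) auto
  then have "norm (r + r') \<le> real (length (a # as)) * ((1 + K + 2 * K\<^sup>2) * b * \<bar>t\<bar> ^ 3)"
    using r(1) r'(1) norm_triangle_ineq[of r r'] by (simp add: algebra_simps)
  moreover have "(\<Prod>a\<leftarrow>a # as. 1 + a * (iexp t - 1))
      = exp (\<i> * t * (\<Sum>a\<leftarrow>a # as. a) - (\<Sum>a\<leftarrow>a # as. a - a\<^sup>2) * t\<^sup>2 / 2 + (r + r'))"
  proof -
    have "(\<Prod>a\<leftarrow>a # as. 1 + a * (iexp t - 1)) = exp (\<i> * t * a - (a - a\<^sup>2) * t\<^sup>2 / 2 + r')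
      * exp (\<i> * t * (\<Sum>a\<leftarrow>as. a) - (\<Sum>a\<leftarrow>as. a - a\<^sup>2) * t\<^sup>2 / 2 + r)"
      unfolding r(2)[symmetric] r'(2)[symmetric] by simp
    then show ?thesis
      unfolding exp_add[symmetric] by (simp add: algebra_simps add_divide_distrib diff_divide_distrib)
  qed
  ultimately show ?case by blast
qed simp

section \<open>Mean and variance from the factorization\<close>

text \<open>The first two elementary symmetric functions, the second through power sums by Newton's
  identity.\<close>

lemma coeff_prod_list_linear:
  fixes as :: "'a::comm_ring_1 list"
  defines "P \<equiv> (\<Prod>a\<leftarrow>as. [:1, a:])"
  shows "coeff P 1 = (\<Sum>a\<leftarrow>as. a)" "2 * coeff P 2 = (\<Sum>a\<leftarrow>as. a)\<^sup>2 - (\<Sum>a\<leftarrow>as. a\<^sup>2)"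
proof -
  have "coeff P 0 = 1 \<and> coeff P 1 = (\<Sum>a\<leftarrow>as. a) \<and> 2 * coeff P 2 = (\<Sum>a\<leftarrow>as. a)\<^sup>2 - (\<Sum>a\<leftarrow>as. a\<^sup>2)"
    unfolding P_def
  proof (induction as)
    case (Cons a as)
    then show ?case
      by (simp add: numeral_2_eq_2 power2_eq_square algebra_simps)
  qed simp
  then show "coeff P 1 = (\<Sum>a\<leftarrow>as. a)" "2 * coeff P 2 = (\<Sum>a\<leftarrow>as. a)\<^sup>2 - (\<Sum>a\<leftarrow>as. a\<^sup>2)"
    by auto
qed

text \<open>Compare the coefficients of \<open>y\<close> and \<open>y\<^sup>2\<close>: on the left
  they are the mean and half the second factorial moment for the weights \<open>p\<close>, on the
  right elementary symmetric functions of the list.\<close>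

lemma factorial_moments_of_factorization:
  fixes p :: "'a \<Rightarrow> complex" and c :: "'a \<Rightarrow> nat" and as :: "complex list"
  assumes eq: "\<And>y. (\<Sum>I\<in>S. p I * (1 + y) ^ c I) = (\<Prod>a\<leftarrow>as. 1 + a * y)"
  shows "(\<Sum>I\<in>S. p I * of_nat (c I)) = (\<Sum>a\<leftarrow>as. a)"
    and "(\<Sum>I\<in>S. p I * of_nat (c I) ^ 2) - (\<Sum>I\<in>S. p I * of_nat (c I)) ^ 2 = (\<Sum>a\<leftarrow>as. a - a\<^sup>2)"
proof -
  \<comment> \<open>\<open>(1 + y) ^ k\<close> is a product of \<open>k\<close> factors with
    \<open>a = 1\<close>, so the same coefficient formulas apply to it.\<close>
  define Q where "Q k = (\<Prod>a\<leftarrow>replicate k (1 :: complex). [:1, a:])" for k :: nat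
  define P :: "complex poly" where "P = (\<Sum>I\<in>S. smult (p I) (Q (c I)))"
  have Qeq: "poly (Q k) y = (1 + y) ^ k" for k and y :: complex
    by (induction k) (auto simp: Q_def algebra_simps)
  have "poly P y = poly (\<Prod>a\<leftarrow>as. [:1, a:]) y" for y
  proof -
    have "poly P y = (\<Prod>a\<leftarrow>as. 1 + a * y)" by (simp add: P_def poly_sum Qeq eq)
    also have "\<dots> = poly (\<Prod>a\<leftarrow>as. [:1, a:]) y" by (induction as) (auto simp: algebra_simps)
    finally show ?thesis .
  qed
  then have PP: "P = (\<Prod>a\<leftarrow>as. [:1, a:])" using poly_eq_poly_eq_iff by blast
  have Q1: "coeff (Q k) 1 = of_nat k" and Q2: "2 * coeff (Q k) 2 = of_nat k ^ 2 - of_nat k" for k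
    using coeff_prod_list_linear[of "replicate k (1::complex)"]
    by (simp_all add: Q_def sum_list_replicate)
  have m1: "(\<Sum>I\<in>S. p I * of_nat (c I)) = (\<Sum>a\<leftarrow>as. a)"
    using coeff_prod_list_linear(1)[of as] unfolding PP[symmetric] by (simp add: P_def coeff_sum Q1[simplified])
  then show "(\<Sum>I\<in>S. p I * of_nat (c I)) = (\<Sum>a\<leftarrow>as. a)" .
  have "2 * coeff P 2 = (\<Sum>I\<in>S. p I * (2 * coeff (Q (c I)) 2))"
    by (simp add: P_def coeff_sum sum_distrib_left mult_ac)
  also have "\<dots> = (\<Sum>I\<in>S. p I * of_nat (c I) ^ 2) - (\<Sum>I\<in>S. p I * of_nat (c I))"
    by (simp only: Q2 right_diff_distrib sum_subtractf)
  finally have "(\<Sum>I\<in>S. p I * of_nat (c I) ^ 2) - (\<Sum>a\<leftarrow>as. a) = (\<Sum>a\<leftarrow>as. a)\<^sup>2 - (\<Sum>a\<leftarrow>as. a\<^sup>2)"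
    using coeff_prod_list_linear(2)[of as] unfolding PP[symmetric] m1 by simp
  then show "(\<Sum>I\<in>S. p I * of_nat (c I) ^ 2) - (\<Sum>I\<in>S. p I * of_nat (c I)) ^ 2 = (\<Sum>a\<leftarrow>as. a - a\<^sup>2)"
    by (simp add: m1 sum_list_subtractf algebra_simps)
qed

section \<open>The characteristic function away from the origin\<close>

text \<open>Taylor's formula gives \<open>1 - cos t \<ge> t\<^sup>2 / 2 - t ^ 4 / 24\<close>, and
  \<open>t\<^sup>2 \<le> 10\<close> in this range leaves \<open>t\<^sup>2 / 12\<close>.\<close>

lemma one_minus_cos_ge:
  assumes "\<bar>t\<bar> \<le> pi"
  shows "t\<^sup>2 / 16 \<le> 1 - cos t"
proof -
  have "\<bar>Re (iexp t - (\<Sum>k\<le>3. (\<i> * t) ^ k / fact k))\<bar> \<le> \<bar>t\<bar> ^ 4 / fact 4"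
    using iexp_approx1[of t 3] abs_Re_le_cmod order_trans by fastforce
  moreover have "Re (iexp t - (\<Sum>k\<le>3. (\<i> * t) ^ k / fact k)) = cos t - 1 + t\<^sup>2 / 2"
    by (simp add: numeral_eq_Suc Re_exp)
  moreover have "\<bar>t\<bar> ^ 4 / fact 4 = t\<^sup>2 * t\<^sup>2 / 24"
    by (simp add: fact_numeral power4_eq_xxxx power2_eq_square mult.assoc abs_mult_self_eq)
  moreover have "t\<^sup>2 * t\<^sup>2 \<le> 10 * t\<^sup>2"
  proof (rule mult_right_mono)
    have "t\<^sup>2 \<le> (3.15)\<^sup>2" using assms pi_approx by (intro iffD1[OF abs_le_square_iff]) auto
    then show "t\<^sup>2 \<le> 10" by (simp add: power2_eq_square)
  qed simp
  ultimately show ?thesis by (simp add: abs_le_iff)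
qed

text \<open>
  Fix a set of vertices with pairwise disjoint and non-adjacent closed neighbourhoods and condition on the
  configuration outside of them. The neighbourhoods become independent, and in each of them the centre is
  free with probability bounded below, which gives a factor \<open>1 - \<kappa>\<close>.
\<close>

lemma norm_indep_poly_iexp_le:
  fixes l t :: real
  assumes "finite V" "E \<subseteq> V \<times> V" "sym E" "irrefl E" and deg: "\<And>v. card (E `` {v}) \<le> D"
    and l: "l > 0" and t: "\<bar>t\<bar> \<le> pi"
  shows "norm (indep_poly E V (of_real l * iexp t))
    \<le> exp (- (l * t\<^sup>2 * real (card V) / (16 * (1 + l) ^ (D + 2) * (real D + 1) ^ 3))) * indep_poly E V l"
proof -
  obtain S where S: "S \<subseteq> V" "card V \<le> card S * (D + 1) ^ 3"
    "\<And>s u. s \<in> S \<Longrightarrow> u \<in> S \<Longrightarrow> s \<noteq> u \<Longrightarrow>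
       insert s (E `` {s}) \<inter> insert u (E `` {u}) = {} \<and> E `` insert s (E `` {s}) \<inter> insert u (E `` {u}) = {}"
    using separated_set_exists[OF assms(1-3) deg] by blast
  let ?z = "of_real l * iexp t"
  \<comment> \<open>The exponent is \<open>D + 1\<close> for the weight of a star with at most
    \<open>D + 1\<close> vertices, plus one for the denominator of the gain in
    \<open>norm (1 + ?z)\<close>.\<close>
  define \<kappa> where "\<kappa> = l * (1 - cos t) / (1 + l) ^ (D + 2)"
  have nz: "norm ?z = l" using l by (simp add: norm_mult)
  have finE: "finite (E `` X)" for X by (rule finite_subset[OF _ assms(1)]) (use assms(2) in auto)
  have \<kappa>0: "\<kappa> \<ge> 0" using l by (simp add: \<kappa>_def)
  have "norm (1 + ?z) \<le> 1 + l - l * (1 - cos t) / (1 + l)"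
  proof (rule power2_le_imp_le)
    have "(norm (1 + ?z))\<^sup>2 = (1 + l * cos t)\<^sup>2 + (l * sin t)\<^sup>2"
      by (simp add: cmod_power2 Re_exp Im_exp)
    also have "\<dots> = 1 + 2 * l * cos t + l\<^sup>2 * ((cos t)\<^sup>2 + (sin t)\<^sup>2)"
      by algebra
    also have "(cos t)\<^sup>2 + (sin t)\<^sup>2 = 1" by simp
    also have "1 + 2 * l * cos t + l\<^sup>2 * 1 = (1 + l)\<^sup>2 - 2 * (l * (1 - cos t))"
      by (simp add: power2_eq_square algebra_simps)
    also have "\<dots> \<le> (1 + l - l * (1 - cos t) / (1 + l))\<^sup>2"
    proof -
      define x where "x = l * (1 - cos t) / (1 + l)"
      have "(1 + l) * x = l * (1 - cos t)" using l by (simp add: x_def)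
      moreover have "(1 + l - x)\<^sup>2 = (1 + l)\<^sup>2 - 2 * ((1 + l) * x) + x\<^sup>2"
        by algebra
      ultimately show ?thesis by (simp add: x_def)
    qed
    finally show "(norm (1 + ?z))\<^sup>2 \<le> (1 + l - l * (1 - cos t) / (1 + l))\<^sup>2" .
    have "l * (1 - cos t) \<le> l * 2" using l cos_ge_minus_one[of t] by (intro mult_left_mono) auto
    also have "\<dots> \<le> (1 + l) * (1 + l)" using l by (simp add: algebra_simps)
    finally show "0 \<le> 1 + l - l * (1 - cos t) / (1 + l)" using l by (simp add: pos_divide_le_eq)
  qed
  have star: "norm (indep_poly E (insert s (E `` {s}) - E `` J) ?z)
      \<le> (1 - \<kappa>) * indep_poly E (insert s (E `` {s}) - E `` J) (norm ?z)"
    if s: "s \<in> S" "J \<inter> insert s (E `` {s}) = {}" for s J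
  proof -
    define T where "T = E `` {s} - E `` J"
    have T: "finite T" "insert s (E `` {s}) - E `` J = insert s T" "s \<notin> T"
      using s assms(3,4) finE by (auto simp: T_def irrefl_def dest: symD)
    have "card T \<le> D" using card_mono[of "E `` {s}" T] finE deg[of s] by (force simp: T_def)
    \<comment> \<open>The centre \<open>s\<close> is adjacent to all of \<open>T\<close>, so a
      stable set containing it contains nothing else.\<close>
    have rec: "indep_poly E (insert s T) x = indep_poly E T x + x" for x :: "'b::comm_semiring_1"
    proof -
      have e: "insert s T - insert s (E `` {s}) = {}" by (auto simp: T_def)
      have "indep_poly E (insert s T) x
          = indep_poly E (insert s T - {s}) x + x * indep_poly E (insert s T - insert s (E `` {s})) x"
        by (rule indep_poly_rec) (use T assms(3,4) in \<open>auto simp: irrefl_def\<close>)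
      then show ?thesis unfolding e using T(3) by simp
    qed
    \<comment> \<open>The empty set is singled out: its term \<open>1\<close> and the term
      \<open>x\<close> of the centre form \<open>1 + x\<close>, from which the whole gain is
      drawn.\<close>
    have split: "indep_poly E T x = 1 + (\<Sum>I\<in>stable_sets E T - {{}}. x ^ card I)" for x :: "'b::comm_semiring_1"
      unfolding indep_poly_def using T(1)
      by (subst sum.remove[of _ "{}"]) (auto intro: finite_stable_sets empty_in_stable_sets)
    have "norm (indep_poly E (insert s T) ?z) \<le> norm (1 + ?z) + norm (\<Sum>I\<in>stable_sets E T - {{}}. ?z ^ card I)"
      unfolding rec split by (rule order_trans[OF _ norm_triangle_ineq]) (simp add: add_ac)
    also have "norm (\<Sum>I\<in>stable_sets E T - {{}}. ?z ^ card I) \<le> (\<Sum>I\<in>stable_sets E T - {{}}. l ^ card I)"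
      by (rule sum_norm_le) (simp add: norm_power nz)
    also have "norm (1 + ?z) + \<dots> \<le> indep_poly E (insert s T) l - l * (1 - cos t) / (1 + l)"
      unfolding rec split using \<open>norm (1 + ?z) \<le> _\<close> by simp
    also have "\<dots> \<le> indep_poly E (insert s T) l - \<kappa> * indep_poly E (insert s T) l"
    proof -
      have "indep_poly E (insert s T) l \<le> (1 + l) ^ (card (insert s T))"
        using T l assms by (intro indep_poly_le_power) auto
      also have "\<dots> \<le> (1 + l) ^ (D + 1)" using T \<open>card T \<le> D\<close> l by (intro power_increasing) auto
      finally have "\<kappa> * indep_poly E (insert s T) l \<le> \<kappa> * (1 + l) ^ (D + 1)" using \<kappa>0 by (rule mult_left_mono)
      also have "\<dots> = l * (1 - cos t) / (1 + l)" using l by (simp add: \<kappa>_def)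
      finally show ?thesis by simp
    qed
    finally show ?thesis unfolding T(2) nz by (simp add: algebra_simps)
  qed
  have \<kappa>1: "\<kappa> \<le> 1"
  proof -
    have "l * (1 - cos t) \<le> l * 2" using l cos_ge_minus_one[of t] by (intro mult_left_mono) auto
    also have "\<dots> \<le> (1 + l) ^ 2" using l by (simp add: power2_eq_square algebra_simps)
    also have "\<dots> \<le> (1 + l) ^ (D + 2)" using l by (intro power_increasing) auto
    finally show ?thesis using l by (simp add: \<kappa>_def)
  qed
  have "norm (indep_poly E V ?z) \<le> (1 - \<kappa>) ^ card S * indep_poly E V (norm ?z)"
  proof (rule norm_indep_poly_le_prod[where B = "\<lambda>s. insert s (E `` {s})"])
    show "finite S" using S(1) assms(1) by (rule finite_subset)
    show "insert s (E `` {s}) \<subseteq> V" if "s \<in> S" for s using that S(1) assms(2) by auto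
  qed (use assms S(3) star in blast)+
  also have "\<dots> \<le> exp (- (l * t\<^sup>2 * real (card V) / (16 * (1 + l) ^ (D + 2) * (real D + 1) ^ 3))) * indep_poly E V (norm ?z)"
  proof (rule mult_right_mono)
    have "(1 - \<kappa>) ^ card S \<le> exp (- \<kappa>) ^ card S"
      using exp_ge_add_one_self[of "- \<kappa>"] \<kappa>1 by (intro power_mono) auto
    also have "\<dots> = exp (- (\<kappa> * real (card S)))" by (simp add: mult.commute flip: exp_of_nat_mult)
    also have "\<dots> \<le> exp (- (l * t\<^sup>2 * real (card V) / (16 * (1 + l) ^ (D + 2) * (real D + 1) ^ 3)))"
    proof -
      have "real (card V) \<le> real (card S * (D + 1) ^ 3)" using S(2) by (rule of_nat_mono)
      then have "real (card V) / (real D + 1) ^ 3 \<le> real (card S)"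
        by (simp add: pos_divide_le_eq add.commute)
      moreover have "l * (t\<^sup>2 / 16) / (1 + l) ^ (D + 2) \<le> \<kappa>"
        unfolding \<kappa>_def using l one_minus_cos_ge[OF t] by (intro divide_right_mono mult_left_mono) auto
      ultimately have "(l * (t\<^sup>2 / 16) / (1 + l) ^ (D + 2)) * (real (card V) / (real D + 1) ^ 3) \<le> \<kappa> * real (card S)"
        using \<kappa>0 by (intro mult_mono) auto
      then show ?thesis by (simp add: mult_ac)
    qed
    finally show "(1 - \<kappa>) ^ card S \<le> exp (- (l * t\<^sup>2 * real (card V) / (16 * (1 + l) ^ (D + 2) * (real D + 1) ^ 3)))" .
    show "0 \<le> indep_poly E V (norm ?z)"
      by (rule order_trans[OF zero_le_one indep_poly_ge_1]) (simp_all add: assms(1))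
  qed
  finally show ?thesis unfolding nz .
qed

section \<open>From characteristic functions to local limits\<close>

lemma integrable_exp_neg_square:
  assumes "c > 0"
  shows "integrable lborel (\<lambda>x::real. exp (- (c * x\<^sup>2)))"
proof -
  define s where "s = 1 / sqrt (2 * c)"
  have s2: "s\<^sup>2 = 1 / (2 * c)" using assms by (simp add: s_def power_divide)
  then have "normal_density 0 s x * sqrt (2 * pi * s\<^sup>2) = exp (- (c * x\<^sup>2))" for x
    using assms by (simp add: normal_density_def mult.commute)
  moreover have "integrable lborel (\<lambda>x. normal_density 0 s x * sqrt (2 * pi * s\<^sup>2))"
    using assms by (intro integrable_mult_left integrable_normal_density) (simp add: s_def)
  ultimately show ?thesis by simp
qed

lemma gaussian_fourier:
  fixes x :: real
  shows "integrable lborel (\<lambda>s. iexp (- (s * x)) * exp (- s\<^sup>2 / 2))"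
    and "(LINT s|lborel. iexp (- (s * x)) * exp (- s\<^sup>2 / 2)) = sqrt (2 * pi) * exp (- x\<^sup>2 / 2)"
proof -
  have "integrable lborel (\<lambda>s. complex_of_real (exp (- (1 / 2 * s\<^sup>2))))"
    by (intro integrable_of_real integrable_exp_neg_square) simp
  then show "integrable lborel (\<lambda>s. iexp (- (s * x)) * exp (- s\<^sup>2 / 2))"
    by (rule Bochner_Integration.integrable_bound) (auto simp: norm_mult)
  have "complex_of_real (exp (- (- x)\<^sup>2 / 2)) = (LINT s|std_normal_distribution. iexp (- x * s))"
    using fun_cong[OF char_std_normal_distribution, of "- x"] unfolding char_def by simp
  also have "\<dots> = (LINT s|lborel. std_normal_density s *\<^sub>R iexp (- x * s))"
    by (rule integral_density) auto
  also have "\<dots> = (LINT s|lborel. of_real (1 / sqrt (2 * pi)) * (iexp (- (s * x)) * exp (- s\<^sup>2 / 2)))"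
    by (intro Bochner_Integration.integral_cong)
      (simp_all add: std_normal_density_def scaleR_conv_of_real mult_ac)
  also have "\<dots> = of_real (1 / sqrt (2 * pi)) * (LINT s|lborel. iexp (- (s * x)) * exp (- s\<^sup>2 / 2))"
    by simp
  finally show "(LINT s|lborel. iexp (- (s * x)) * exp (- s\<^sup>2 / 2)) = sqrt (2 * pi) * exp (- x\<^sup>2 / 2)"
    by (simp add: field_simps flip: of_real_mult)
qed

text \<open>Orthogonality of characters over a full period, rescaled by \<open>b\<close>: for
  \<open>m \<noteq> 0\<close> the antiderivative takes the same value at both ends.\<close>

lemma lattice_fourier:
  fixes m :: int and b :: real
  assumes b: "b > 0"
  shows "has_bochner_integral lborel (\<lambda>s. indicator {- (pi * b)..pi * b} s *\<^sub>R iexp (s * m / b))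
    (if m = 0 then of_real (2 * pi * b) else 0)"
proof (cases "m = 0")
  case True
  have "has_bochner_integral lborel (\<lambda>s. indicator {- (pi * b)..pi * b} s *\<^sub>R (1 :: complex))
      (measure lborel {- (pi * b)..pi * b} *\<^sub>R 1)"
    by (intro has_bochner_integral_scaleR_left has_bochner_integral_real_indicator) (auto simp: emeasure_lborel_Icc_eq)
  then show ?thesis using True b by (simp add: scaleR_conv_of_real mult.assoc)
next
  case False
  define F where "F s = iexp (s * m / b) * (b / (\<i> * m))" for s :: real
  have nz: "\<i> * of_int m \<noteq> (0::complex)" using False by simp
  have "has_bochner_integral lborel (\<lambda>s. indicator {- (pi * b)..pi * b} s *\<^sub>R iexp (s * m / b))
      (F (pi * b) - F (- (pi * b)))"
  proof (rule has_bochner_integral_FTC_Icc)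
    show "- (pi * b) \<le> pi * b" using b by simp
    show "continuous_on {- (pi * b)..pi * b} (\<lambda>s. iexp (s * m / b))"
      by (intro continuous_intros) (use b in auto)
    fix s :: real
    let ?F = "\<lambda>z. exp (\<i> * (z * of_int m / of_real b)) * (of_real b / (\<i> * of_int m))"
    have "(?F has_field_derivative iexp (s * m / b)) (at (of_real s))"
      using b nz by (auto intro!: derivative_eq_intros simp: algebra_simps)
    from has_vector_derivative_real_field[OF this]
    have "(F has_vector_derivative iexp (s * m / b)) (at s)" by (simp add: F_def[abs_def])
    then show "(F has_vector_derivative iexp (s * m / b)) (at s within {- (pi * b)..pi * b})"
      by (rule has_vector_derivative_at_within)
  qed
  moreover have "F (pi * b) - F (- (pi * b)) = 0"
  proof -
    have "iexp (pi * m) = iexp (- (pi * m))"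
      unfolding exp_eq by (rule exI[of _ m]) (simp add: algebra_simps)
    then show ?thesis using b by (simp add: F_def)
  qed
  ultimately show ?thesis using False by simp
qed

text \<open>Fourier inversion, on the lattice for \<open>w k\<close> and on the line for the
  Gaussian, turns both into integrals over \<open>s\<close>. Their integrands share the phase
  \<open>iexp (- (s * x))\<close> of modulus \<open>1\<close>, which carries all dependence on
  \<open>k\<close>, so the bound is uniform in \<open>k\<close>.\<close>

lemma lattice_local_limit_bound:
  fixes w :: "int \<Rightarrow> real" and \<mu> \<sigma> :: real
  assumes S: "finite S" and \<sigma>: "\<sigma> > 0"
  defines "\<phi> \<equiv> \<lambda>t. \<Sum>j\<in>S. w j * iexp (t * j)"
  shows "\<bar>(if k \<in> S then w k else 0) - 1 / (sqrt (2 * pi) * \<sigma>) * exp (- (k - \<mu>)\<^sup>2 / (2 * \<sigma>\<^sup>2))\<bar>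
    \<le> 1 / (2 * pi * \<sigma>) * (LINT s|lborel.
        norm (indicator {- (pi * \<sigma>)..pi * \<sigma>} s *\<^sub>R (\<phi> (s / \<sigma>) * iexp (- (s * \<mu> / \<sigma>)))
          - complex_of_real (exp (- s\<^sup>2 / 2))))"
proof -
  let ?I = "\<lambda>s. indicator {- (pi * \<sigma>)..pi * \<sigma>} s :: real"
  let ?J = "\<lambda>s. ?I s *\<^sub>R (\<phi> (s / \<sigma>) * iexp (- (s * \<mu> / \<sigma>))) - complex_of_real (exp (- s\<^sup>2 / 2))"
  let ?wk = "if k \<in> S then w k else 0"
  define x where "x = (k - \<mu>) / \<sigma>"
  have "has_bochner_integral lborel (\<lambda>s. \<Sum>j\<in>S. of_real (w j) * (?I s *\<^sub>R iexp (s * real_of_int (j - k) / \<sigma>)))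
      (\<Sum>j\<in>S. of_real (w j) * (if j - k = 0 then of_real (2 * pi * \<sigma>) else 0))"
    by (intro has_bochner_integral_sum has_bochner_integral_mult_right lattice_fourier[OF \<sigma>])
  moreover have "(\<Sum>j\<in>S. of_real (w j) * (if j - k = 0 then complex_of_real (2 * pi * \<sigma>) else 0))
      = of_real (?wk * (2 * pi * \<sigma>))"
  proof -
    have "(\<Sum>j\<in>S. of_real (w j) * (if j - k = 0 then complex_of_real (2 * pi * \<sigma>) else 0))
        = (\<Sum>j\<in>S. if j = k then of_real (w j) * complex_of_real (2 * pi * \<sigma>) else 0)"
      by (intro sum.cong) auto
    then show ?thesis using S by (simp add: sum.delta)
  qed
  moreover have "(\<lambda>s. \<Sum>j\<in>S. of_real (w j) * (?I s *\<^sub>R iexp (s * real_of_int (j - k) / \<sigma>)))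
      = (\<lambda>s. ?I s *\<^sub>R (\<phi> (s / \<sigma>) * iexp (- (s * k / \<sigma>))))"
  proof
    fix s :: real
    have eq: "of_real (w j) * (?I s *\<^sub>R iexp (s * real_of_int (j - k) / \<sigma>))
        = ?I s *\<^sub>R (w j * iexp (s / \<sigma> * j) * iexp (- (s * k / \<sigma>)))" for j
      by (simp add: mult.assoc diff_divide_distrib algebra_simps flip: exp_add)
    show "(\<Sum>j\<in>S. of_real (w j) * (?I s *\<^sub>R iexp (s * real_of_int (j - k) / \<sigma>)))
        = ?I s *\<^sub>R (\<phi> (s / \<sigma>) * iexp (- (s * k / \<sigma>)))"
      unfolding \<phi>_def sum_distrib_right scaleR_sum_right by (intro sum.cong refl eq)
  qed
  ultimately have "has_bochner_integral lborel (\<lambda>s. ?I s *\<^sub>R (\<phi> (s / \<sigma>) * iexp (- (s * k / \<sigma>)))) (of_real (?wk * (2 * pi * \<sigma>)))"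
    by simp
  moreover have "has_bochner_integral lborel (\<lambda>s. iexp (- (s * x)) * exp (- s\<^sup>2 / 2)) (sqrt (2 * pi) * exp (- x\<^sup>2 / 2))"
    using gaussian_fourier[of x] by (simp add: has_bochner_integral_iff)
  ultimately have "has_bochner_integral lborel
      (\<lambda>s. ?I s *\<^sub>R (\<phi> (s / \<sigma>) * iexp (- (s * k / \<sigma>))) - iexp (- (s * x)) * exp (- s\<^sup>2 / 2))
      (complex_of_real (?wk * (2 * pi * \<sigma>)) - complex_of_real (sqrt (2 * pi) * exp (- x\<^sup>2 / 2)))"
    by (rule has_bochner_integral_diff)
  moreover have "?I s *\<^sub>R (\<phi> (s / \<sigma>) * iexp (- (s * k / \<sigma>))) - iexp (- (s * x)) * exp (- s\<^sup>2 / 2)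
      = iexp (- (s * x)) * ?J s" for s
  proof -
    have "iexp (- (s * k / \<sigma>)) = iexp (- (s * x)) * iexp (- (s * \<mu> / \<sigma>))"
      by (simp add: x_def algebra_simps diff_divide_distrib flip: exp_add)
    then show ?thesis by (simp add: algebra_simps)
  qed
  ultimately have int: "has_bochner_integral lborel (\<lambda>s. iexp (- (s * x)) * ?J s)
      (complex_of_real (?wk * (2 * pi * \<sigma>)) - complex_of_real (sqrt (2 * pi) * exp (- x\<^sup>2 / 2)))"
    by simp
  have "norm (of_real (?wk * (2 * pi * \<sigma>)) - complex_of_real (sqrt (2 * pi) * exp (- x\<^sup>2 / 2)))
      \<le> (LINT s|lborel. norm (iexp (- (s * x)) * ?J s))"
    using has_bochner_integral_integral_eq[OF int] integral_norm_bound[of lborel "\<lambda>s. iexp (- (s * x)) * ?J s"]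
    by simp
  also have "\<dots> = (LINT s|lborel. norm (?J s))" by (simp add: norm_mult)
  finally have le: "\<bar>?wk * (2 * pi * \<sigma>) - sqrt (2 * pi) * exp (- x\<^sup>2 / 2)\<bar> \<le> (LINT s|lborel. norm (?J s))"
    by (simp only: flip: of_real_diff) (simp only: norm_of_real)
  have g: "1 / (sqrt (2 * pi) * \<sigma>) = sqrt (2 * pi) / (2 * pi * \<sigma>)"
    using \<sigma> by (simp add: field_simps)
  have e: "- (k - \<mu>)\<^sup>2 / (2 * \<sigma>\<^sup>2) = - x\<^sup>2 / 2" by (simp add: x_def power_divide)
  have "?wk - 1 / (sqrt (2 * pi) * \<sigma>) * exp (- (k - \<mu>)\<^sup>2 / (2 * \<sigma>\<^sup>2))
      = 1 / (2 * pi * \<sigma>) * (?wk * (2 * pi * \<sigma>) - sqrt (2 * pi) * exp (- x\<^sup>2 / 2))"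
    unfolding g e using \<sigma> by (simp add: field_simps)
  then have "\<bar>?wk - 1 / (sqrt (2 * pi) * \<sigma>) * exp (- (k - \<mu>)\<^sup>2 / (2 * \<sigma>\<^sup>2))\<bar>
      = 1 / (2 * pi * \<sigma>) * \<bar>?wk * (2 * pi * \<sigma>) - sqrt (2 * pi) * exp (- x\<^sup>2 / 2)\<bar>"
    using \<sigma> by (simp only: abs_mult) simp
  also have "\<dots> \<le> 1 / (2 * pi * \<sigma>) * (LINT s|lborel. norm (?J s))"
    using le \<sigma> by (intro mult_left_mono) auto
  finally show ?thesis .
qed

section \<open>Variance lower bound and convergence of the Fourier integrals\<close>

text \<open>Compare the two estimates of \<open>norm (\<phi> t)\<close> as \<open>t\<close> tends to \<open>0\<close>.\<close>

lemma variance_ge_of_char_bounds: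
  fixes \<phi> :: "real \<Rightarrow> complex" and \<mu> v N c C t0 :: real
  assumes N: "N > 0" and C: "C > 0" and t0: "t0 > 0"
    and exp: "\<And>t. \<bar>t\<bar> \<le> t0 \<Longrightarrow> \<exists>r. norm r \<le> C * N * \<bar>t\<bar> ^ 3 \<and> \<phi> t = exp (\<i> * t * \<mu> - v * t\<^sup>2 / 2 + r)"
    and bound: "\<And>t. \<bar>t\<bar> \<le> pi \<Longrightarrow> norm (\<phi> t) \<le> exp (- (c * N * t\<^sup>2))"
  shows "2 * c * N \<le> v"
proof (rule ccontr)
  assume "\<not> ?thesis"
  then have gap: "c * N - v / 2 > 0" by simp
  \<comment> \<open>The last entry makes the cubic remainder at most half of the gap times
    \<open>t\<^sup>2\<close>.\<close>
  define t where "t = Min {t0, pi, (c * N - v / 2) / (2 * C * N)}"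
  have t: "t > 0" "t \<le> t0" "t \<le> pi" "t \<le> (c * N - v / 2) / (2 * C * N)"
    using gap N C t0 by (auto simp: t_def)
  obtain r where r: "norm r \<le> C * N * \<bar>t\<bar> ^ 3" "\<phi> t = exp (\<i> * t * \<mu> - v * t\<^sup>2 / 2 + r)"
    using exp[of t] t by auto
  have "exp (- v * t\<^sup>2 / 2 + Re r) = norm (\<phi> t)"
    by (simp add: r(2) power2_eq_square)
  also have "\<dots> \<le> exp (- (c * N * t\<^sup>2))" using bound[of t] t by simp
  finally have "- v * t\<^sup>2 / 2 + Re r \<le> - (c * N * t\<^sup>2)" by simp
  moreover have "- (C * N * t ^ 3) \<le> Re r" using r(1) abs_Re_le_cmod[of r] t(1) by simp
  ultimately have "t\<^sup>2 * (c * N - v / 2) \<le> C * N * t ^ 3" by (simp add: algebra_simps)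
  also have "\<dots> = t\<^sup>2 * (C * N * t)" by (simp add: power2_eq_square power3_eq_cube)
  finally have "c * N - v / 2 \<le> C * N * t" using t(1) by simp
  also have "\<dots> \<le> C * N * ((c * N - v / 2) / (2 * C * N))" using t(4) C N by (intro mult_left_mono) auto
  also have "\<dots> = (c * N - v / 2) / 2" using C N by simp
  finally have le: "c * N - v / 2 \<le> (c * N - v / 2) / 2" .
  have "\<not> x \<le> x / 2" if "x > 0" for x :: real using that by simp
  from this[OF gap] show False using le by blast
qed

text \<open>Dominated convergence. The bound \<open>2 * c * N n \<le> (\<sigma> n)\<^sup>2\<close>
  sends \<open>\<sigma>\<close> to infinity and makes the remainder at \<open>s / \<sigma> n\<close>
  of order \<open>\<bar>s\<bar> ^ 3 / \<sigma> n\<close>; the bound \<open>var\<close> turns the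
  decay of \<open>\<phi>\<close> into a fixed Gaussian majorant.\<close>

lemma char_L1_convergence:
  fixes \<phi> :: "nat \<Rightarrow> real \<Rightarrow> complex" and \<mu> \<sigma> N :: "nat \<Rightarrow> real" and c C C' t0 :: real
  assumes meas [measurable]: "\<And>n. \<phi> n \<in> borel_measurable borel"
    and \<sigma>: "\<And>n. \<sigma> n > 0" and N: "\<And>n. N n > 0" "filterlim N at_top sequentially"
    and pos: "c > 0" "C > 0" "C' > 0" "t0 > 0"
    and exp: "\<And>n t. \<bar>t\<bar> \<le> t0 \<Longrightarrow>
      \<exists>r. norm r \<le> C * N n * \<bar>t\<bar> ^ 3 \<and> \<phi> n t = exp (\<i> * t * \<mu> n - (\<sigma> n)\<^sup>2 * t\<^sup>2 / 2 + r)"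
    and bound: "\<And>n t. \<bar>t\<bar> \<le> pi \<Longrightarrow> norm (\<phi> n t) \<le> exp (- (c * N n * t\<^sup>2))"
    and var: "\<And>n. (\<sigma> n)\<^sup>2 \<le> C' * N n"
  shows "(\<lambda>n. LINT s|lborel. norm (indicator {- (pi * \<sigma> n)..pi * \<sigma> n} s *\<^sub>R
      (\<phi> n (s / \<sigma> n) * iexp (- (s * \<mu> n / \<sigma> n))) - complex_of_real (exp (- s\<^sup>2 / 2)))) \<longlonglongrightarrow> 0"
proof -
  let ?J = "\<lambda>n s. indicator {- (pi * \<sigma> n)..pi * \<sigma> n} s *\<^sub>R
      (\<phi> n (s / \<sigma> n) * iexp (- (s * \<mu> n / \<sigma> n))) - complex_of_real (exp (- s\<^sup>2 / 2))"
  have low: "2 * c * N n \<le> (\<sigma> n)\<^sup>2" for n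
    using variance_ge_of_char_bounds[OF N(1)[of n] pos(2,4), of "\<phi> n" "\<mu> n" "(\<sigma> n)\<^sup>2" c] exp bound
    by (simp add: of_real_power)
  have "filterlim (\<lambda>n. sqrt (2 * c * N n)) at_top sequentially"
    by (intro filterlim_compose[OF sqrt_at_top] filterlim_tendsto_pos_mult_at_top[OF tendsto_const _ N(2)]) (use pos in auto)
  then have \<sigma>top: "filterlim \<sigma> at_top sequentially"
  proof (rule filterlim_at_top_mono)
    show "\<forall>\<^sub>F n in sequentially. sqrt (2 * c * N n) \<le> \<sigma> n"
      using low \<sigma> by (intro always_eventually allI real_le_lsqrt) (auto intro: less_imp_le)
  qed
  obtain r where r: "\<And>n t. \<bar>t\<bar> \<le> t0 \<Longrightarrow> norm (r n t) \<le> C * N n * \<bar>t\<bar> ^ 3"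
    "\<And>n t. \<bar>t\<bar> \<le> t0 \<Longrightarrow> \<phi> n t = exp (\<i> * t * \<mu> n - (\<sigma> n)\<^sup>2 * t\<^sup>2 / 2 + r n t)"
  proof -
    have "\<forall>n t. \<exists>r. \<bar>t\<bar> \<le> t0 \<longrightarrow> norm r \<le> C * N n * \<bar>t\<bar> ^ 3 \<and>
        \<phi> n t = exp (\<i> * t * \<mu> n - (\<sigma> n)\<^sup>2 * t\<^sup>2 / 2 + r)"
      using exp by blast
    then obtain r where "\<forall>n t. \<bar>t\<bar> \<le> t0 \<longrightarrow> norm (r n t) \<le> C * N n * \<bar>t\<bar> ^ 3 \<and>
        \<phi> n t = exp (\<i> * t * \<mu> n - (\<sigma> n)\<^sup>2 * t\<^sup>2 / 2 + r n t)"
      by metis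
    then show ?thesis using that[of r] by blast
  qed
  have lim: "(\<lambda>n. norm (?J n s)) \<longlonglongrightarrow> 0" for s
  proof -
    have ev1: "\<forall>\<^sub>F n in sequentially. \<bar>s\<bar> / t0 \<le> \<sigma> n" and ev2: "\<forall>\<^sub>F n in sequentially. \<bar>s\<bar> / pi \<le> \<sigma> n"
      using \<sigma>top by (auto simp: filterlim_at_top)
    have "(\<lambda>n. r n (s / \<sigma> n)) \<longlonglongrightarrow> 0"
    proof (rule Lim_null_comparison)
      show "(\<lambda>n. C * \<bar>s\<bar> ^ 3 / (2 * c) / \<sigma> n) \<longlonglongrightarrow> 0"
        by (rule tendsto_divide_0[OF tendsto_const filterlim_at_top_imp_at_infinity[OF \<sigma>top]])
      show "\<forall>\<^sub>F n in sequentially. norm (r n (s / \<sigma> n)) \<le> C * \<bar>s\<bar> ^ 3 / (2 * c) / \<sigma> n"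
        using ev1
      proof eventually_elim
        case (elim n)
        then have "\<bar>s / \<sigma> n\<bar> \<le> t0" using \<sigma>[of n] pos by (simp add: field_simps)
        then have "norm (r n (s / \<sigma> n)) \<le> C * N n * \<bar>s / \<sigma> n\<bar> ^ 3" by (rule r(1))
        also have "\<dots> \<le> C * ((\<sigma> n)\<^sup>2 / (2 * c)) * \<bar>s / \<sigma> n\<bar> ^ 3"
          using low[of n] pos by (intro mult_right_mono mult_left_mono) (auto simp: field_simps)
        also have "\<dots> = C * \<bar>s\<bar> ^ 3 / (2 * c) / \<sigma> n"
          using \<sigma>[of n] by (simp add: power2_eq_square power3_eq_cube field_simps)
        finally show ?case .
      qed
    qed
    then have "(\<lambda>n. norm (complex_of_real (exp (- s\<^sup>2 / 2)) * (exp (r n (s / \<sigma> n)) - 1))) \<longlonglongrightarrow>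
        norm (complex_of_real (exp (- s\<^sup>2 / 2)) * (exp 0 - 1))"
      by (intro tendsto_intros)
    also have "norm (complex_of_real (exp (- s\<^sup>2 / 2)) * (exp 0 - 1)) = 0" by simp
    finally show ?thesis
    proof (rule Lim_transform_eventually)
      show "\<forall>\<^sub>F n in sequentially. norm (complex_of_real (exp (- s\<^sup>2 / 2)) * (exp (r n (s / \<sigma> n)) - 1)) = norm (?J n s)"
        using ev1 ev2
    proof eventually_elim
      case (elim n)
      have "\<bar>s / \<sigma> n\<bar> \<le> t0" "\<bar>s\<bar> \<le> pi * \<sigma> n" using elim \<sigma>[of n] pos by (simp_all add: field_simps)
      then have ind: "s \<in> {- (pi * \<sigma> n)..pi * \<sigma> n}"
        and \<phi>: "\<phi> n (s / \<sigma> n) = exp (\<i> * (s / \<sigma> n) * \<mu> n - (\<sigma> n)\<^sup>2 * (s / \<sigma> n)\<^sup>2 / 2 + r n (s / \<sigma> n))"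
        using r(2)[of "s / \<sigma> n" n] by auto
      have "\<phi> n (s / \<sigma> n) * iexp (- (s * \<mu> n / \<sigma> n)) = exp (complex_of_real (- s\<^sup>2 / 2) + r n (s / \<sigma> n))"
        unfolding \<phi> exp_add[symmetric] using \<sigma>[of n] by (simp add: power_divide)
      also have "\<dots> = complex_of_real (exp (- s\<^sup>2 / 2)) * exp (r n (s / \<sigma> n))"
        by (simp only: exp_add exp_of_real)
      finally show ?case using ind by (simp add: algebra_simps)
    qed
    qed
  qed
  have dom: "norm (?J n s) \<le> exp (- (c / C' * s\<^sup>2)) + exp (- (1 / 2 * s\<^sup>2))" for n s
  proof -
    have "norm (indicator {- (pi * \<sigma> n)..pi * \<sigma> n} s *\<^sub>R (\<phi> n (s / \<sigma> n) * iexp (- (s * \<mu> n / \<sigma> n))))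
      \<le> exp (- (c / C' * s\<^sup>2))"
    proof (cases "s \<in> {- (pi * \<sigma> n)..pi * \<sigma> n}")
      case True
      then have "\<bar>s / \<sigma> n\<bar> \<le> pi" using \<sigma>[of n] by (simp add: abs_le_iff field_simps)
      then have "norm (\<phi> n (s / \<sigma> n)) \<le> exp (- (c * N n * (s / \<sigma> n)\<^sup>2))" by (rule bound)
      also have "\<dots> \<le> exp (- (c / C' * s\<^sup>2))"
      proof -
        have "1 / C' \<le> N n / (\<sigma> n)\<^sup>2" using var[of n] \<sigma>[of n] pos by (simp add: field_simps)
        then have "c * s\<^sup>2 * (1 / C') \<le> c * s\<^sup>2 * (N n / (\<sigma> n)\<^sup>2)" using pos by (intro mult_left_mono) auto
        then show ?thesis by (simp add: power_divide mult_ac)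
      qed
      finally show ?thesis using True by (simp add: norm_mult)
    qed simp
    then show ?thesis
      by (intro order_trans[OF norm_triangle_ineq4 add_mono]) auto
  qed
  have "(\<lambda>n. LINT s|lborel. norm (?J n s)) \<longlonglongrightarrow> (LINT s|(lborel :: real measure). 0)"
  proof (rule integral_dominated_convergence)
    show "integrable lborel (\<lambda>s. exp (- (c / C' * s\<^sup>2)) + exp (- (1 / 2 * s\<^sup>2)))"
      using pos by (intro Bochner_Integration.integrable_add integrable_exp_neg_square) auto
    show "AE s in lborel. (\<lambda>n. norm (?J n s)) \<longlonglongrightarrow> 0" using lim by simp
    show "AE s in lborel. norm (norm (?J n s)) \<le> exp (- (c / C' * s\<^sup>2)) + exp (- (1 / 2 * s\<^sup>2))" for n
      using dom by simp
  qed simp_all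
  then show ?thesis by simp
qed

section \<open>Uniform estimates for graphs of bounded degree\<close>

lemma norm_sum_list_le:
  fixes f :: "'a \<Rightarrow> 'b::real_normed_vector"
  assumes "\<And>x. x \<in> set xs \<Longrightarrow> norm (f x) \<le> b"
  shows "norm (\<Sum>x\<leftarrow>xs. f x) \<le> real (length xs) * b"
  using assms
proof (induction xs)
  case (Cons x xs)
  then have "norm (f x) + norm (\<Sum>x\<leftarrow>xs. f x) \<le> b + real (length xs) * b"
    by (intro add_mono) auto
  then show ?case
    using norm_triangle_ineq[of "f x" "\<Sum>x\<leftarrow>xs. f x"] by (simp add: distrib_right)
qed simp

text \<open>All constants are fixed before the graph and the fugacity, so they serve a whole
  sequence at once. Zero-freeness enters through the bound \<open>l / \<eta>\<close> on the
  coefficients of the factorization.\<close>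

lemma indep_poly_char_estimates:
  fixes D :: nat and \<delta> \<Lambda> :: real
  assumes D: "D \<ge> 3" and \<delta>: "0 < \<delta>" "\<delta> < 1"
    and \<Lambda>: "\<Lambda> = (1 - \<delta>) * ((real D - 1) ^ (D - 1) / (real D - 2) ^ D)"
  obtains c C C' t0 :: real where "c > 0" "C > 0" "C' > 0" "t0 > 0"
    "\<And>(E :: 'a rel) V l \<phi> \<mu> v. finite V \<Longrightarrow> E \<subseteq> V \<times> V \<Longrightarrow> sym E \<Longrightarrow> irrefl E \<Longrightarrow>
       (\<And>v. card (E `` {v}) \<le> D) \<Longrightarrow> 0 < l \<Longrightarrow> l \<le> \<Lambda> \<Longrightarrow>
       \<phi> = (\<lambda>t. indep_poly E V (of_real l * iexp t) / of_real (indep_poly E V l)) \<Longrightarrow>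
       \<mu> = (\<Sum>I\<in>stable_sets E V. l ^ card I / indep_poly E V l * real (card I)) \<Longrightarrow>
       v = (\<Sum>I\<in>stable_sets E V. l ^ card I / indep_poly E V l * (real (card I))\<^sup>2) - \<mu>\<^sup>2 \<Longrightarrow>
       (\<forall>t. \<bar>t\<bar> \<le> t0 \<longrightarrow> (\<exists>r. norm r \<le> C * (real (card V) * l) * \<bar>t\<bar> ^ 3 \<and>
         \<phi> t = exp (\<i> * t * \<mu> - v * t\<^sup>2 / 2 + r))) \<and>
       (\<forall>t. \<bar>t\<bar> \<le> pi \<longrightarrow> norm (\<phi> t) \<le> exp (- (c * (real (card V) * l) * t\<^sup>2))) \<and>
       v \<le> C' * (real (card V) * l)"
proof -
  define d where "d = D - 1"
  have d: "d > 1" "D = d + 1" using D by (auto simp: d_def)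
  \<comment> \<open>\<open>L\<close> is the logarithmic distance of \<open>\<Lambda>\<close> from
    the critical fugacity, which in terms of \<open>d\<close> is
    \<open>d ^ d / (d - 1) ^ (d + 1)\<close>.\<close>
  define L where "L = - ln (1 - \<delta>)"
  have L: "L > 0" using \<delta> by (simp add: L_def)
  have \<Lambda>0: "\<Lambda> > 0" using D \<delta> unfolding \<Lambda> by simp
  have sub: "ln \<Lambda> + L \<le> d * ln d - (d + 1) * ln (d - 1)"
  proof -
    have "\<Lambda> = (1 - \<delta>) * (real d ^ d / real (d - 1) ^ (d + 1))"
      using d by (simp add: \<Lambda> of_nat_diff)
    moreover have "real d ^ d > 0" "real (d - 1) ^ (d + 1) > 0" using d by auto
    moreover have "ln ((1 - \<delta>) * (A / B)) = ln (1 - \<delta>) + (ln A - ln B)" if "A > 0" "B > 0" for A B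
      using \<delta> that by (simp add: ln_mult ln_div)
    ultimately have "ln \<Lambda> = ln (1 - \<delta>) + (ln (real d ^ d) - ln (real (d - 1) ^ (d + 1)))"
      by blast
    then show ?thesis using d by (simp only: ln_realpow of_nat_0_less_iff L_def)
  qed
  obtain \<eta> :: real where \<eta>: "\<eta> > 0"
    and zf: "\<And>(E :: 'a rel) A l z. sym E \<Longrightarrow> irrefl E \<Longrightarrow> (\<And>v. finite (E `` {v})) \<Longrightarrow>
       (\<And>v. card (E `` {v}) \<le> d + 1) \<Longrightarrow> finite A \<Longrightarrow> 0 \<le> l \<Longrightarrow> l \<le> \<Lambda> \<Longrightarrow>
       norm (z - complex_of_real l) \<le> \<eta> \<Longrightarrow> indep_poly E A z \<noteq> 0"
    using indep_poly_zero_free[OF d(1) L \<Lambda>0 sub, where ?'a = 'a] by blast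
  \<comment> \<open>\<open>K\<close> bounds the coefficients \<open>a\<close> for all fugacities up
    to \<open>\<Lambda>\<close>; \<open>t0\<close> then ensures \<open>\<bar>t\<bar> \<le> 1\<close>
    and \<open>K * \<bar>t\<bar> \<le> 1 / 2\<close>.\<close>
  define K where "K = \<Lambda> / \<eta>"
  have K: "K > 0" using \<Lambda>0 \<eta> by (simp add: K_def)
  define t0 where "t0 = min 1 (1 / (2 * K))"
  define C where "C = (1 + K + 2 * K\<^sup>2) / \<eta>"
  define C' where "C' = (1 + K) / \<eta>"
  define c where "c = 1 / (16 * (1 + \<Lambda>) ^ (D + 2) * (real D + 1) ^ 3)"
  show ?thesis
  proof (rule that[of c C C' t0])
    show "c > 0" "C > 0" "C' > 0" "t0 > 0"
      using K \<eta> \<Lambda>0 by (auto simp: c_def C_def C'_def t0_def intro!: divide_pos_pos add_pos_nonneg mult_pos_pos)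
    fix E :: "'a rel" and V l \<phi> \<mu> v
    assume V: "finite V" "E \<subseteq> V \<times> V" "sym E" "irrefl E" and deg: "\<And>v. card (E `` {v}) \<le> D"
      and l: "0 < l" "l \<le> \<Lambda>"
      and \<phi>: "\<phi> = (\<lambda>t. indep_poly E V (of_real l * iexp t) / of_real (indep_poly E V l))"
      and \<mu>: "\<mu> = (\<Sum>I\<in>stable_sets E V. l ^ card I / indep_poly E V l * real (card I))"
      and v: "v = (\<Sum>I\<in>stable_sets E V. l ^ card I / indep_poly E V l * (real (card I))\<^sup>2) - \<mu>\<^sup>2"
    let ?Z = "indep_poly E V l"
    have Z: "?Z > 0" by (rule less_le_trans[OF zero_less_one indep_poly_ge_1]) (use V l in auto)
    have Zc: "indep_poly E V (of_real l) = complex_of_real ?Z" by (simp add: indep_poly_def)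
    have finE: "finite (E `` X)" for X by (rule finite_subset[OF _ V(1)]) (use V(2) in auto)
    have nz: "indep_poly E V z \<noteq> 0" if "norm (z - complex_of_real l) \<le> \<eta>" for z
      using zf[of E V l z] V l that finE deg d(2) by simp
    obtain as :: "complex list" where as: "length as \<le> card V" "\<And>a. a \<in> set as \<Longrightarrow> norm a \<le> l / \<eta>"
      "\<And>y. indep_poly E V (of_real l * (1 + y)) = indep_poly E V (of_real l) * (\<Prod>a\<leftarrow>as. 1 + a * y)"
      using indep_poly_factorization[OF V(1) less_imp_le[OF l(1)] \<eta> nz] by blast
    define p :: "'a set \<Rightarrow> complex" where "p I = of_real (l ^ card I / ?Z)" for I
    have gen: "(\<Sum>I\<in>stable_sets E V. p I * (1 + y) ^ card I) = (\<Prod>a\<leftarrow>as. 1 + a * y)" for y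
    proof -
      have "(\<Sum>I\<in>stable_sets E V. p I * (1 + y) ^ card I) = indep_poly E V (of_real l * (1 + y)) / of_real ?Z"
        by (simp add: p_def indep_poly_def[of _ _ "of_real l * (1 + y)"] sum_divide_distrib power_mult_distrib)
      then show ?thesis using as(3)[of y] Zc Z by simp
    qed
    have m: "(\<Sum>a\<leftarrow>as. a) = of_real \<mu>"
      using factorial_moments_of_factorization(1)[OF gen] by (simp add: p_def \<mu>)
    have vv: "(\<Sum>a\<leftarrow>as. a - a\<^sup>2) = of_real v"
      using factorial_moments_of_factorization(2)[OF gen] unfolding v \<mu> by (simp add: p_def)
    have len: "real (length as) \<le> real (card V)" using as(1) by simp
    have bK: "l / \<eta> \<le> K" using l \<eta> by (simp add: K_def divide_right_mono)
    have \<phi>prod: "\<phi> t = (\<Prod>a\<leftarrow>as. 1 + a * (iexp t - 1))" for t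
      using as(3)[of "iexp t - 1"] Zc Z by (simp add: \<phi>)
    have "\<exists>r. norm r \<le> C * (real (card V) * l) * \<bar>t\<bar> ^ 3 \<and> \<phi> t = exp (\<i> * t * \<mu> - v * t\<^sup>2 / 2 + r)"
      if t: "\<bar>t\<bar> \<le> t0" for t
    proof -
      have t1: "\<bar>t\<bar> \<le> 1" "K * \<bar>t\<bar> \<le> 1 / 2"
        using t K by (auto simp: t0_def field_simps)
      have "\<exists>r. norm r \<le> real (length as) * ((1 + K + 2 * K\<^sup>2) * (l / \<eta>) * \<bar>t\<bar> ^ 3) \<and>
          \<phi> t = exp (\<i> * t * \<mu> - v * t\<^sup>2 / 2 + r)"
        using iexp_prod_expansion[of as, OF as(2) bK t1] unfolding m vv \<phi>prod of_real_mult of_real_divide of_real_power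
          of_real_numeral .
      then obtain r where r: "norm r \<le> real (length as) * ((1 + K + 2 * K\<^sup>2) * (l / \<eta>) * \<bar>t\<bar> ^ 3)"
        "\<phi> t = exp (\<i> * t * \<mu> - v * t\<^sup>2 / 2 + r)"
        by (elim exE conjE)
      have "real (length as) * ((1 + K + 2 * K\<^sup>2) * (l / \<eta>) * \<bar>t\<bar> ^ 3)
          \<le> real (card V) * ((1 + K + 2 * K\<^sup>2) * (l / \<eta>) * \<bar>t\<bar> ^ 3)"
        using len K l \<eta> by (intro mult_right_mono) auto
      also have "\<dots> = C * (real (card V) * l) * \<bar>t\<bar> ^ 3" by (simp add: C_def mult_ac)
      finally show ?thesis using r by (intro exI[of _ r]) simp
    qed
    moreover have "norm (\<phi> t) \<le> exp (- (c * (real (card V) * l) * t\<^sup>2))" if t: "\<bar>t\<bar> \<le> pi" for t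
    proof -
      have "norm (indep_poly E V (of_real l * iexp t))
          \<le> exp (- (l * t\<^sup>2 * real (card V) / (16 * (1 + l) ^ (D + 2) * (real D + 1) ^ 3))) * ?Z"
        using norm_indep_poly_iexp_le[OF V deg l(1) t] .
      then have "norm (\<phi> t) \<le> exp (- (l * t\<^sup>2 * real (card V) / (16 * (1 + l) ^ (D + 2) * (real D + 1) ^ 3)))"
        using Z by (simp add: \<phi> norm_divide pos_divide_le_eq)
      also have "\<dots> \<le> exp (- (l * t\<^sup>2 * real (card V) / (16 * (1 + \<Lambda>) ^ (D + 2) * (real D + 1) ^ 3)))"
        unfolding exp_le_cancel_iff neg_le_iff_le using l
        by (intro divide_left_mono mult_right_mono mult_left_mono power_mono mult_pos_pos) auto
      also have "\<dots> = exp (- (c * (real (card V) * l) * t\<^sup>2))" by (simp add: c_def mult_ac)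
      finally show ?thesis .
    qed
    moreover have "v \<le> C' * (real (card V) * l)"
    proof -
      have "norm (a - a\<^sup>2) \<le> (1 + K) * (l / \<eta>)" if a: "a \<in> set as" for a
      proof -
        have "norm (a - a\<^sup>2) \<le> norm a + norm a * norm a"
          by (intro order_trans[OF norm_triangle_ineq4]) (simp add: power2_eq_square norm_mult)
        also have "\<dots> \<le> l / \<eta> + K * (l / \<eta>)"
          using as(2)[OF a] bK K by (intro add_mono mult_mono) auto
        finally show ?thesis by (simp only: distrib_right mult_1)
      qed
      then have "norm (\<Sum>a\<leftarrow>as. a - a\<^sup>2) \<le> real (length as) * ((1 + K) * (l / \<eta>))"
        by (rule norm_sum_list_le)
      also have "\<dots> \<le> real (card V) * ((1 + K) * (l / \<eta>))" using len K l \<eta> by (intro mult_right_mono) auto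
      finally have "\<bar>v\<bar> \<le> real (card V) * ((1 + K) * (l / \<eta>))" unfolding vv by simp
      then show ?thesis by (simp add: C'_def mult_ac)
    qed
    ultimately show "(\<forall>t. \<bar>t\<bar> \<le> t0 \<longrightarrow> (\<exists>r. norm r \<le> C * (real (card V) * l) * \<bar>t\<bar> ^ 3 \<and>
         \<phi> t = exp (\<i> * t * \<mu> - v * t\<^sup>2 / 2 + r))) \<and>
       (\<forall>t. \<bar>t\<bar> \<le> pi \<longrightarrow> norm (\<phi> t) \<le> exp (- (c * (real (card V) * l) * t\<^sup>2))) \<and>
       v \<le> C' * (real (card V) * l)" by blast
  qed
qed

section \<open>The hard-core model\<close>

lemma independent_sets_eq: "independent_sets G = stable_sets (parcs G) (pverts G)"
  by (simp add: independent_sets_def stable_sets_def)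

lemma partition_function_eq: "partition_function G l = indep_poly (parcs G) (pverts G) l"
  by (simp add: partition_function_def indep_poly_def independent_sets_eq)

lemma pair_graph_arcs:
  assumes "pair_graph G"
  shows "finite (pverts G)" "parcs G \<subseteq> pverts G \<times> pverts G" "sym (parcs G)" "irrefl (parcs G)"
proof -
  interpret pair_graph G by fact
  show "finite (pverts G)" by (rule pair_finite_verts)
  show "parcs G \<subseteq> pverts G \<times> pverts G" by (auto dest: in_arcsD1 in_arcsD2)
  show "sym (parcs G)" using pair_sym_arcs by (simp add: symmetric_def)
  show "irrefl (parcs G)" by (force simp: irrefl_def dest: pair_no_loops)
qed

lemma card_neighbours_le_max_degree:
  assumes "pair_graph G"
  shows "card (parcs G `` {v}) \<le> max_degree G"
proof (cases "v \<in> pverts G")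
  case True
  have "out_arcs (with_proj G) v = Pair v ` (parcs G `` {v})" by (auto simp: out_arcs_def)
  then have "out_degree (with_proj G) v = card (parcs G `` {v})"
    unfolding out_degree_def by (simp add: card_image inj_on_def)
  then show ?thesis
    unfolding max_degree_def using True pair_graph_arcs(1)[OF assms]
    by (metis Max_ge finite_imageI imageI)
next
  case False
  then have "parcs G `` {v} = {}" using pair_graph_arcs(2)[OF assms] by auto
  then show ?thesis by simp
qed

context
  fixes G :: "'a pair_pre_digraph" and l :: real
  assumes G: "pair_graph G" and l: "l > 0"
begin

lemma set_pmf_hard_core: "set_pmf (hard_core G l) = independent_sets G"
  using partition_function_pos[OF G l] l by (auto simp: set_pmf_eq pmf_hard_core[OF G l])

lemma expectation_hard_core:
  "measure_pmf.expectation (hard_core G l) f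
    = (\<Sum>I\<in>independent_sets G. l ^ card I / partition_function G l * f I)"
  by (subst integral_measure_pmf_real[OF finite_independent_sets[OF G]])
    (auto simp: set_pmf_hard_core pmf_hard_core[OF G l] mult.commute intro!: sum.cong)

lemma hard_core_mean_eq:
  "hard_core_mean G l = (\<Sum>I\<in>independent_sets G. l ^ card I / partition_function G l * real (card I))"
  by (simp add: hard_core_mean_def expectation_hard_core)

lemma hard_core_sd_sq:
  "(hard_core_sd G l)\<^sup>2 = (\<Sum>I\<in>independent_sets G. l ^ card I / partition_function G l * (real (card I))\<^sup>2)
     - (hard_core_mean G l)\<^sup>2"
proof -
  have "integrable (hard_core G l) f" for f :: "'a set \<Rightarrow> real"
    by (rule integrable_measure_pmf_finite) (simp add: set_pmf_hard_core finite_independent_sets[OF G])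
  then have "measure_pmf.variance (hard_core G l) (\<lambda>I. real (card I))
      = measure_pmf.expectation (hard_core G l) (\<lambda>I. (real (card I))\<^sup>2)
        - (measure_pmf.expectation (hard_core G l) (\<lambda>I. real (card I)))\<^sup>2"
    by (intro measure_pmf.variance_eq)
  moreover have "measure_pmf.variance (hard_core G l) (\<lambda>I. real (card I)) \<ge> 0"
    by (rule measure_pmf.variance_positive)
  ultimately show ?thesis
    by (simp add: hard_core_sd_def hard_core_mean_def expectation_hard_core)
qed

lemma hard_core_sd_nonneg: "hard_core_sd G l \<ge> 0"
  unfolding hard_core_sd_def using measure_pmf.variance_positive by simp

lemma prob_card_hard_core:
  "measure_pmf.prob (hard_core G l) {I. int (card I) = k}
    = (\<Sum>I\<in>{I \<in> independent_sets G. int (card I) = k}. l ^ card I / partition_function G l)"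
proof -
  let ?A = "{I \<in> independent_sets G. int (card I) = k}"
  have "measure_pmf.prob (hard_core G l) {I. int (card I) = k} = measure_pmf.prob (hard_core G l) ?A"
    by (subst measure_Int_set_pmf[symmetric]) (simp add: set_pmf_hard_core Int_def conj_commute)
  also have "\<dots> = (\<Sum>I\<in>?A. pmf (hard_core G l) I)"
    using finite_independent_sets[OF G] by (intro measure_measure_pmf_finite) simp
  also have "\<dots> = (\<Sum>I\<in>?A. l ^ card I / partition_function G l)"
    by (intro sum.cong) (auto simp: pmf_hard_core[OF G l])
  finally show ?thesis .
qed

text \<open>Group the independent sets by size; up to normalisation each one contributes
  \<open>(l * iexp t) ^ card I\<close>.\<close>

lemma hard_core_char:
  fixes t :: real
  shows "(\<Sum>k\<in>(\<lambda>I. int (card I)) ` independent_sets G.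
      measure_pmf.prob (hard_core G l) {I. int (card I) = k} * iexp (t * k))
    = indep_poly (parcs G) (pverts G) (of_real l * iexp t) / of_real (indep_poly (parcs G) (pverts G) l)"
proof -
  let ?S = "(\<lambda>I. int (card I)) ` independent_sets G"
  let ?p = "\<lambda>I. l ^ card I / partition_function G l"
  have "(\<Sum>k\<in>?S. measure_pmf.prob (hard_core G l) {I. int (card I) = k} * iexp (t * k))
      = (\<Sum>k\<in>?S. \<Sum>I\<in>{I \<in> independent_sets G. int (card I) = k}. ?p I * iexp (t * card I))"
    by (intro sum.cong refl) (auto simp: prob_card_hard_core sum_distrib_right intro!: sum.cong)
  also have "\<dots> = (\<Sum>I\<in>independent_sets G. ?p I * iexp (t * card I))"
    using finite_independent_sets[OF G] by (intro sum.group) auto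
  also have "\<dots> = indep_poly (parcs G) (pverts G) (of_real l * iexp t) / of_real (indep_poly (parcs G) (pverts G) l)"
    unfolding indep_poly_def[of _ _ "of_real l * iexp t"] sum_divide_distrib independent_sets_eq partition_function_eq
    by (intro sum.cong) (auto simp: power_mult_distrib mult_ac simp flip: exp_of_nat_mult)
  finally show ?thesis .
qed

lemma hard_core_local_limit_bound:
  assumes sd: "hard_core_sd G l > 0"
  defines "\<mu> \<equiv> hard_core_mean G l" and "\<sigma> \<equiv> hard_core_sd G l"
  defines "\<phi> \<equiv> \<lambda>t. indep_poly (parcs G) (pverts G) (of_real l * iexp t) / of_real (indep_poly (parcs G) (pverts G) l)"
  shows "\<bar>measure_pmf.prob (hard_core G l) {I. int (card I) = k}
      - 1 / (sqrt (2 * pi) * \<sigma>) * exp (- (real_of_int k - \<mu>)\<^sup>2 / (2 * \<sigma>\<^sup>2))\<bar>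
    \<le> 1 / (2 * pi * \<sigma>) * (LINT s|lborel.
        norm (indicator {- (pi * \<sigma>)..pi * \<sigma>} s *\<^sub>R (\<phi> (s / \<sigma>) * iexp (- (s * \<mu> / \<sigma>)))
          - complex_of_real (exp (- s\<^sup>2 / 2))))"
proof -
  let ?S = "(\<lambda>I. int (card I)) ` independent_sets G"
  let ?w = "\<lambda>k. measure_pmf.prob (hard_core G l) {I. int (card I) = k}"
  have w: "(if k \<in> ?S then ?w k else 0) = ?w k"
  proof (cases "k \<in> ?S")
    case False
    then have "{I \<in> independent_sets G. int (card I) = k} = {}" by auto
    then have "?w k = 0" unfolding prob_card_hard_core by (simp only: sum.empty)
    then show ?thesis by simp
  qed simp
  have \<phi>: "\<phi> t = (\<Sum>k\<in>?S. ?w k * iexp (t * k))" for t :: real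
    unfolding \<phi>_def by (rule hard_core_char[symmetric])
  have "finite ?S" using finite_independent_sets[OF G] by simp
  then show ?thesis
    using lattice_local_limit_bound[of ?S \<sigma> k ?w \<mu>] sd unfolding w \<phi> \<sigma>_def by blast
qed

end

section \<open>Local central limit theorem for the size of the random independent set\<close>

theorem theorem1p5:
  fixes \<Delta> :: nat
    and \<delta> :: real
    and G :: "nat \<Rightarrow> 'a pair_pre_digraph"
    and l :: "nat \<Rightarrow> real"
    and \<mu> \<sigma> :: "nat \<Rightarrow> real"
  assumes "\<Delta> \<ge> 3"
    and "0 < \<delta>" and "\<delta> < 1"
    and "\<And>n. n \<ge> 1 \<Longrightarrow> pair_graph (G n)"
    and "\<And>n. n \<ge> 1 \<Longrightarrow> card (pverts (G n)) = n"
    and "\<And>n. n \<ge> 1 \<Longrightarrow> max_degree (G n) \<le> \<Delta>"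
    and "\<And>n. n \<ge> 1 \<Longrightarrow> l n > 0"
    and "filterlim (\<lambda>n. real n * l n) at_top sequentially"
    and "\<And>n. n \<ge> 1 \<Longrightarrow> l n \<le> (1 - \<delta>) * critical_fugacity \<Delta>"
    and "\<And>n. \<mu> n = hard_core_mean (G n) (l n)"
    and "\<And>n. \<sigma> n = hard_core_sd (G n) (l n)"
  shows "(\<lambda>n. SUP k::int.
            \<bar>measure_pmf.prob (hard_core (G n) (l n)) {I. int (card I) = k}
              - 1 / (sqrt (2 * pi) * \<sigma> n)
                  * exp (- (real_of_int k - \<mu> n)\<^sup>2 / (2 * (\<sigma> n)\<^sup>2))\<bar>)
         \<in> o[sequentially](\<lambda>n. 1 / \<sigma> n)"
proof -
  let ?E = "\<lambda>n. parcs (G n)" and ?V = "\<lambda>n. pverts (G n)"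
  define \<phi> where "\<phi> n t = indep_poly (?E n) (?V n) (of_real (l n) * iexp t) / of_real (indep_poly (?E n) (?V n) (l n))"
    for n t
  define N where "N n = real n * l n" for n
  obtain c C C' t0 :: real where pos: "c > 0" "C > 0" "C' > 0" "t0 > 0"
    and est: "\<And>(E :: 'a rel) V l \<phi> \<mu> v. finite V \<Longrightarrow> E \<subseteq> V \<times> V \<Longrightarrow> sym E \<Longrightarrow> irrefl E \<Longrightarrow>
       (\<And>v. card (E `` {v}) \<le> \<Delta>) \<Longrightarrow> 0 < l \<Longrightarrow> l \<le> (1 - \<delta>) * critical_fugacity \<Delta> \<Longrightarrow>
       \<phi> = (\<lambda>t. indep_poly E V (of_real l * iexp t) / of_real (indep_poly E V l)) \<Longrightarrow>
       \<mu> = (\<Sum>I\<in>stable_sets E V. l ^ card I / indep_poly E V l * real (card I)) \<Longrightarrow>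
       v = (\<Sum>I\<in>stable_sets E V. l ^ card I / indep_poly E V l * (real (card I))\<^sup>2) - \<mu>\<^sup>2 \<Longrightarrow>
       (\<forall>t. \<bar>t\<bar> \<le> t0 \<longrightarrow> (\<exists>r. norm r \<le> C * (real (card V) * l) * \<bar>t\<bar> ^ 3 \<and>
         \<phi> t = exp (\<i> * t * \<mu> - v * t\<^sup>2 / 2 + r))) \<and>
       (\<forall>t. \<bar>t\<bar> \<le> pi \<longrightarrow> norm (\<phi> t) \<le> exp (- (c * (real (card V) * l) * t\<^sup>2))) \<and>
       v \<le> C' * (real (card V) * l)"
    by (rule indep_poly_char_estimates[OF assms(1-3) refl, folded critical_fugacity_def]) blast
  have main: "(\<forall>t. \<bar>t\<bar> \<le> t0 \<longrightarrow> (\<exists>r. norm r \<le> C * N n * \<bar>t\<bar> ^ 3 \<and>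
         \<phi> n t = exp (\<i> * t * \<mu> n - (\<sigma> n)\<^sup>2 * t\<^sup>2 / 2 + r))) \<and>
       (\<forall>t. \<bar>t\<bar> \<le> pi \<longrightarrow> norm (\<phi> n t) \<le> exp (- (c * N n * t\<^sup>2))) \<and> (\<sigma> n)\<^sup>2 \<le> C' * N n"
    if n: "n \<ge> 1" for n
  proof -
    note g = pair_graph_arcs[OF assms(4)[OF n]]
    have deg: "card (?E n `` {v}) \<le> \<Delta>" for v
      using card_neighbours_le_max_degree[OF assms(4)[OF n]] assms(6)[OF n] order_trans by blast
    have 1: "\<phi> n = (\<lambda>t. indep_poly (?E n) (?V n) (of_real (l n) * iexp t) / of_real (indep_poly (?E n) (?V n) (l n)))"
      by (simp add: \<phi>_def[abs_def])
    have 2: "\<mu> n = (\<Sum>I\<in>stable_sets (?E n) (?V n). l n ^ card I / indep_poly (?E n) (?V n) (l n) * real (card I))"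
      unfolding assms(10) hard_core_mean_eq[OF assms(4)[OF n] assms(7)[OF n]] independent_sets_eq partition_function_eq ..
    have 3: "(\<sigma> n)\<^sup>2 = (\<Sum>I\<in>stable_sets (?E n) (?V n).
        l n ^ card I / indep_poly (?E n) (?V n) (l n) * (real (card I))\<^sup>2) - (\<mu> n)\<^sup>2"
      unfolding assms(10,11) hard_core_sd_sq[OF assms(4)[OF n] assms(7)[OF n]] independent_sets_eq partition_function_eq ..
    show ?thesis
      using est[OF g deg assms(7)[OF n] assms(9)[OF n] 1 2 3] unfolding N_def assms(5)[OF n] .
  qed
  have Npos: "N n > 0" if "n \<ge> 1" for n using assms(7)[OF that] that by (simp add: N_def)
  \<comment> \<open>Non-degeneracy follows from comparing the expansion at \<open>0\<close> with the
    global decay.\<close>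
  have \<sigma>pos: "\<sigma> n > 0" if n: "n \<ge> 1" for n
  proof -
    have "2 * c * N n \<le> (\<sigma> n)\<^sup>2"
      using variance_ge_of_char_bounds[OF Npos[OF n] pos(2,4), of "\<phi> n" "\<mu> n" "(\<sigma> n)\<^sup>2" c] main[OF n] by blast
    moreover have "2 * c * N n > 0" using pos Npos[OF n] by simp
    ultimately have "\<sigma> n \<noteq> 0" by auto
    then show ?thesis using hard_core_sd_nonneg[OF assms(4)[OF n] assms(7)[OF n]] assms(11)[of n] by simp
  qed
  define J where "J n = (LINT s|lborel.
        norm (indicator {- (pi * \<sigma> n)..pi * \<sigma> n} s *\<^sub>R (\<phi> n (s / \<sigma> n) * iexp (- (s * \<mu> n / \<sigma> n)))
          - complex_of_real (exp (- s\<^sup>2 / 2))))" for n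
  \<comment> \<open>The hypotheses start at \<open>n = 1\<close>, while the convergence lemma asks
    for bounds at every index; hence the shift, undone in the limit.\<close>
  have "(\<lambda>n. J (Suc n)) \<longlonglongrightarrow> 0"
    unfolding J_def
  proof (rule char_L1_convergence[where N = "\<lambda>n. N (Suc n)" and c = c and C = C and C' = C' and ?t0.0 = t0])
    show "\<phi> (Suc n) \<in> borel_measurable borel" for n
      unfolding \<phi>_def[abs_def] indep_poly_def by measurable
    show "filterlim (\<lambda>n. N (Suc n)) at_top sequentially"
      using assms(8) unfolding N_def by (rule filterlim_compose[OF _ filterlim_Suc])
  qed (use pos main Npos \<sigma>pos in auto)
  then have "J \<longlonglongrightarrow> 0" by (rule LIMSEQ_imp_Suc)
  show ?thesis
  proof (rule landau_o.smallI)
    fix e :: real assume e: "e > 0"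
    \<comment> \<open>The threshold \<open>2 * pi * e\<close> offsets the prefactor
      \<open>1 / (2 * pi * \<sigma> n)\<close> of the error bound.\<close>
    have "\<forall>\<^sub>F n in sequentially. J n < 2 * pi * e"
      using \<open>J \<longlonglongrightarrow> 0\<close> e by (intro order_tendstoD) auto
    then show "\<forall>\<^sub>F n in sequentially. norm (SUP k::int.
            \<bar>measure_pmf.prob (hard_core (G n) (l n)) {I. int (card I) = k}
              - 1 / (sqrt (2 * pi) * \<sigma> n) * exp (- (real_of_int k - \<mu> n)\<^sup>2 / (2 * (\<sigma> n)\<^sup>2))\<bar>)
        \<le> e * norm (1 / \<sigma> n)"
      using eventually_ge_at_top[of 1]
    proof eventually_elim
      case (elim n)
      note n = elim(2)
      let ?f = "\<lambda>k::int. \<bar>measure_pmf.prob (hard_core (G n) (l n)) {I. int (card I) = k}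
              - 1 / (sqrt (2 * pi) * \<sigma> n) * exp (- (real_of_int k - \<mu> n)\<^sup>2 / (2 * (\<sigma> n)\<^sup>2))\<bar>"
      have le: "?f k \<le> e * (1 / \<sigma> n)" for k
      proof -
        have "?f k \<le> 1 / (2 * pi * \<sigma> n) * J n"
          using hard_core_local_limit_bound[OF assms(4)[OF n] assms(7)[OF n], of k] \<sigma>pos[OF n]
          unfolding J_def \<phi>_def assms(10,11) by simp
        also have "\<dots> \<le> 1 / (2 * pi * \<sigma> n) * (2 * pi * e)"
          using elim(1) \<sigma>pos[OF n] by (intro mult_left_mono) auto
        finally show ?thesis by simp
      qed
      have "(SUP k. ?f k) \<le> e * (1 / \<sigma> n)" by (rule cSUP_least) (use le in auto)
      \<comment> \<open>A nonnegative value below the supremum removes the norm around it;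
        \<open>le\<close> supplies the boundedness.\<close>
      moreover have "?f 0 \<le> (SUP k. ?f k)"
        by (rule cSUP_upper) (use le in \<open>auto simp: bdd_above_def\<close>)
      then have "0 \<le> (SUP k. ?f k)" by (rule order_trans[OF abs_ge_zero])
      ultimately show ?case using \<sigma>pos[OF n] by simp
    qed
  qed
qed

end
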